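(* Assume that Hypothesis (H) (stated in the context) holds. For every $\mathsf m\in\mathbb N^d$ let $\mathsf a_{\mathsf m},\mathsf b_{\mathsf m}\in\mathbb R^d$ be arbitrarily chosen points, let $\varphi_{\mathsf m,0},\psi_{\mathsf m,T},\mu_{\mathsf m},u_{\mathsf m},v_{\mathsf m}$ be as in the context, and let $Z^{\mathsf m}_{\tau\in[0,T]}$ be the Bernstein process associated with $\mu_{\mathsf m}$. Let $\bar Z_{\tau\in[0,T]}$ be the Bernstein process associated with the probability measure $$\bar\mu=\sum_{\mathsf m\in\mathbb N^d}p_{\mathsf m}\mu_{\mathsf m},\qquad p_{\mathsf m}>0,\quad\sum_{\mathsf m\in\mathbb N^d}p_{\mathsf m}=1 .$$ Then the following statements are valid. (a) The process $\bar Z_{\tau\in[0,T]}$ is non-stationary, non-Markovian and its finite-dimensional distributions are $$\mathbb P_{\bar\mu}\left(\bar Z_{t_1}\in F_1,\dots,\bar Z_{t_n}\in F_n\right)=\sum_{\mathsf m\in\mathbb N^d}p_{\mathsf m}\,\mathbb P_{\mu_{\mathsf m}}\left(Z^{\mathsf m}_{t_1}\in F_1,\dots,Z^{\mathsf m}_{t_n}\in F_n\right)$$ for every $n\in\mathbb N^+$, all $F_1,\dots,F_n\in\mathcal B_d$ and all $0<t_1<\dots<t_n<T$, where $$\mathbb P_{\mu_{\mathsf m}}\left(Z^{\mathsf m}_{t_1}\in F_1,\dots,Z^{\mathsf m}_{t_n}\in F_n\right)=\int_{\mathbb R^d}d\mathsf x\,\varphi_{\mathsf m,0}(\mathsf x)v_{\mathsf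 m}(\mathsf x,0)\int_{F_1}d\mathsf x_1\cdots\int_{F_n}d\mathsf x_n\prod_{k=1}^n g(\mathsf x_{k-1},t_k-t_{k-1},\mathsf x_k)\frac{v_{\mathsf m}(\mathsf x_k,t_k)}{v_{\mathsf m}(\mathsf x_{k-1},t_{k-1})}$$ with $t_0=0$, $\mathsf x_0=\mathsf x$, or equivalently $$\mathbb P_{\mu_{\mathsf m}}\left(Z^{\mathsf m}_{t_1}\in F_1,\dots,Z^{\mathsf m}_{t_n}\in F_n\right)=\int_{\mathbb R^d}d\mathsf x\,\psi_{\mathsf m,T}(\mathsf x)u_{\mathsf m}(\mathsf x,T)\int_{F_1}d\mathsf x_1\cdots\int_{F_n}d\mathsf x_n\prod_{k=1}^n g(\mathsf x_{k+1},t_{k+1}-t_k,\mathsf x_k)\frac{u_{\mathsf m}(\mathsf x_k,t_k)}{u_{\mathsf m}(\mathsf x_{k+1},t_{k+1})}$$ with $t_{n+1}=T$, $\mathsf x_{n+1}=\mathsf x$. (b) We have $$\mathbb P_{\bar\mu}(\bar Z_t\in F)=\sum_{\mathsf m\in\mathbb N^d}p_{\mathsf m}\,\mathbb P_{\mu_{\mathsf m}}(Z^{\mathsf m}_t\in F)$$ for each $t\in[0,T]$ and every $F\in\mathcal B_d$, where $\mathbb P_{\mu_{\mathsf m}}(Z^{\mathsf m}_t\in F)=\int_F d\mathsf x\,u_{\mathsf m}(\mathsf x,t)v_{\mathsf m}(\mathsf x,t)$ for $t\in(0,T)$, $\mathbb P_{\mu_{\mathsf m}}(Z^{\mathsf m}_0\in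 F)$ equals $1$ if $\mathsf a_{\mathsf m}\in F$ and $0$ otherwise, and $\mathbb P_{\mu_{\mathsf m}}(Z^{\mathsf m}_T\in F)$ equals $1$ if $\mathsf b_{\mathsf m}\in F$ and $0$ otherwise. (c) We have $$\mathbb E_{\bar\mu}\left(b(\bar Z_t)\right)=\sum_{\mathsf m\in\mathbb N^d}p_{\mathsf m}\,\mathbb E_{\mu_{\mathsf m}}\left(b(Z^{\mathsf m}_t)\right)$$ for each bounded Borel measurable function $b:\mathbb R^d\to\mathbb C$ and every $t\in[0,T]$, where $\mathbb E_{\mu_{\mathsf m}}(b(Z^{\mathsf m}_t))=\int_{\mathbb R^d}d\mathsf x\,b(\mathsf x)u_{\mathsf m}(\mathsf x,t)v_{\mathsf m}(\mathsf x,t)$ for $t\in(0,T)$.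
   Context: Fix $d\in\mathbb N^+$ and $T\in(0,+\infty)$; $\mathcal B_d$ is the Borel $\sigma$-algebra of $\mathbb R^d$; $\mathbb N=\{0,1,2,\dots\}$. Hypothesis (H): the real-valued function $V$ on $\mathbb R^d$ is bounded from below, $V\in L^\infty_{loc}(\mathbb R^d)$, and $V(\mathsf x)\to+\infty$ as $|\mathsf x|\to+\infty$. $H=-\frac12\Delta_{\mathsf x}+V$ denotes the self-adjoint operator in $L^2(\mathbb R^d)$ associated with the closure of the quadratic form $\mathsf Q(f)=\frac12\sum_{j=1}^d\int|\partial_{x_j}f|^2d\mathsf x+\int V|f|^2d\mathsf x$ defined first on smooth compactly supported complex-valued $f$. It has compact resolvent; its eigenvalues $(E_{\mathsf m})_{\mathsf m\in\mathbb N^d}$ satisfy $E_{\mathsf m}\to+\infty$ as $|\mathsf m|\to+\infty$. Standing assumption: $\mathcal Z(t)=\sum_{\mathsf m\in\mathbb N^d}\exp[-tE_{\mathsf m}]<+\infty$ for every $t\in(0,T]$. Green's function $g(\mathsf x,t,\mathsf y)$ is the (continuous, strictly positive, symmetric in $\mathsf x,\mathsf y$) integral kernel of the semigroup $\exp[-tH]$, $t\in(0,T]$. For each $\mathsf m$, with $\delta$ the Dirac measure, $\varphi_{\mathsf m,0}(\mathsf x)=\delta(\mathsf x-\mathsf a_{\mathsf m})/g^{1/2}(\mathsf a_{\mathsf m},T,\mathsf b_{\mathsf m})$ and $\psi_{\mathsf m,T}(\mathsf x)=\delta(\mathsf x-\mathsf b_{\mathsf m})/g^{1/2}(\mathsf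 a_{\mathsf m},T,\mathsf b_{\mathsf m})$; $\mu_{\mathsf m}$ is the probability measure on $\mathcal B_d\times\mathcal B_d$ with joint density $\varphi_{\mathsf m,0}(\mathsf x)g(\mathsf x,T,\mathsf y)\psi_{\mathsf m,T}(\mathsf y)$; $u_{\mathsf m}(\mathsf x,t)=\int g(\mathsf x,t,\mathsf y)\varphi_{\mathsf m,0}(\mathsf y)d\mathsf y$ and $v_{\mathsf m}(\mathsf x,t)=\int g(\mathsf x,T-t,\mathsf y)\psi_{\mathsf m,T}(\mathsf y)d\mathsf y$. Bernstein process: an $\mathbb R^d$-valued process $Z_{\tau\in[0,T]}$ on a complete probability space $(\Omega,\mathcal F,\mathbb P)$ such that $\mathbb E(b(Z_r)\mid\mathcal F_s^+\vee\mathcal F_t^-)=\mathbb E(b(Z_r)\mid Z_s,Z_t)$ $\mathbb P$-a.e. for every bounded Borel $b:\mathbb R^d\to\mathbb C$ and all $r\in(s,t)\subset[0,T]$, where $\mathcal F_s^+=\sigma\{Z_\tau^{-1}(F):\tau\le s,F\in\mathcal B_d\}$ and $\mathcal F_t^-=\sigma\{Z_\tau^{-1}(F):\tau\ge t,F\in\mathcal B_d\}$. Given a probability measure $\mu$ on $\mathcal B_d\times\mathcal B_d$, the Bernstein process associated with $\mu$ is the Bernstein process on a probability space $(\Omega,\mathcal F,\mathbb P_\mu)$ whose law is determined by $$\mathbb P_\mu(Z_0\in F_0,Z_{t_1}\in F_1,\dots,Z_{t_n}\in F_n,Z_T\in F_T)=\int_{F_0\times F_T}\frac{d\mu(\mathsf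 x,\mathsf y)}{g(\mathsf x,T,\mathsf y)}\int_{F_1}d\mathsf x_1\cdots\int_{F_n}d\mathsf x_n\prod_{k=1}^n g(\mathsf x_k,t_k-t_{k-1},\mathsf x_{k-1})\,g(\mathsf y,T-t_n,\mathsf x_n)$$ for all Borel $F_0,\dots,F_n,F_T$ and $t_0=0<t_1<\dots<t_n<T$, with $\mathsf x_0=\mathsf x$. $\mathbb E_\mu$ is expectation under $\mathbb P_\mu$. A process is stationary if its finite-dimensional distributions are invariant under time translations (within the time interval).
   Formalization: Non-Markovian is claimed only when the masses that the mixed measure puts on endpoint pairs (x,y) are not of the form φ(x)g(x,T,y)ψ(y); for arbitrary points it fails, e.g. if all a_m coincide the mixed process is Markovian. *)

theory Defs
  imports "HOL-Probability.Probability"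
begin

section \<open>The Schroedinger operator\<close>

text \<open>The space is \<open>real ^ 'd\<close>, and families indexed by d-tuples of natural numbers are indexed by
  \<open>nat ^ 'd\<close>. The potential is only Lebesgue measurable, so integrals in this section are taken
  with respect to \<open>lebesgue\<close>. Elements of L2 are represented by functions, and equality in L2 is
  equality almost everywhere.\<close>

definition hypothesis_H :: "(real ^ 'd \<Rightarrow> real) \<Rightarrow> bool" where
  "hypothesis_H V \<longleftrightarrow>
     (\<exists>c. \<forall>x. c \<le> V x) \<and>
     V \<in> borel_measurable lebesgue \<and>
     (\<forall>K. compact K \<longrightarrow> (\<exists>C. AE x in lebesgue. x \<in> K \<longrightarrow> \<bar>V x\<bar> \<le> C)) \<and>
     filterlim V at_top at_infinity"

definition partial_deriv :: "'d \<Rightarrow> (real ^ 'd \<Rightarrow> complex) \<Rightarrow> real ^ 'd \<Rightarrow> complex" where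
  "partial_deriv j f x = frechet_derivative f (at x) (axis j 1)"

primrec iter_partial_deriv :: "'d list \<Rightarrow> (real ^ 'd \<Rightarrow> complex) \<Rightarrow> real ^ 'd \<Rightarrow> complex" where
  "iter_partial_deriv [] f = f"
| "iter_partial_deriv (j # js) f = partial_deriv j (iter_partial_deriv js f)"

text \<open>If every iterated partial derivative is differentiable everywhere, then all of them are
  continuous, so this is the usual class of infinitely differentiable functions.\<close>

definition test_function :: "(real ^ 'd \<Rightarrow> complex) \<Rightarrow> bool" where
  "test_function f \<longleftrightarrow>
     (\<forall>js x. iter_partial_deriv js f differentiable (at x)) \<and> compact (closure {x. f x \<noteq> 0})"

definition L2 :: "(real ^ 'd \<Rightarrow> complex) \<Rightarrow> bool" where
  "L2 f \<longleftrightarrow> f \<in> borel_measurable lebesgue \<and> integrable lebesgue (\<lambda>x. (cmod (f x))\<^sup>2)"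

definition inner2 :: "(real ^ 'd \<Rightarrow> complex) \<Rightarrow> (real ^ 'd \<Rightarrow> complex) \<Rightarrow> complex" where
  "inner2 f h = (LINT x|lebesgue. cnj (f x) * h x)"

definition norm2 :: "(real ^ 'd \<Rightarrow> complex) \<Rightarrow> real" where
  "norm2 f = sqrt (LINT x|lebesgue. (cmod (f x))\<^sup>2)"

definition quad_form :: "(real ^ 'd \<Rightarrow> real) \<Rightarrow> (real ^ 'd \<Rightarrow> complex) \<Rightarrow> real" where
  "quad_form V f =
     (1/2) * (\<Sum>j\<in>UNIV. LINT x|lebesgue. (cmod (partial_deriv j f x))\<^sup>2)
     + (LINT x|lebesgue. V x * (cmod (f x))\<^sup>2)"

text \<open>The sesquilinear form whose diagonal is \<open>quad_form V\<close>, antilinear in the first argument.\<close>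

definition sesq_form ::
    "(real ^ 'd \<Rightarrow> real) \<Rightarrow> (real ^ 'd \<Rightarrow> complex) \<Rightarrow> (real ^ 'd \<Rightarrow> complex) \<Rightarrow> complex" where
  "sesq_form V f h =
     (1/2) * (\<Sum>j\<in>UNIV. LINT x|lebesgue. cnj (partial_deriv j f x) * partial_deriv j h x)
     + (LINT x|lebesgue. complex_of_real (V x) * (cnj (f x) * h x))"

lemma sesq_form_diag: "sesq_form V f f = complex_of_real (quad_form V f)"
proof -
  have cnj_mult: "cnj z * z = complex_of_real ((cmod z)\<^sup>2)" for z
    by (metis complex_norm_square mult.commute)
  show ?thesis
    unfolding sesq_form_def quad_form_def cnj_mult of_real_mult[symmetric] integral_complex_of_real
    by simp
qed

text \<open>Closure of the form: \<open>f\<close> lies in its domain iff some sequence of test functions that is Cauchy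
  for the form converges to \<open>f\<close> in L2.\<close>

definition form_approx ::
    "(real ^ 'd \<Rightarrow> real) \<Rightarrow> (real ^ 'd \<Rightarrow> complex) \<Rightarrow> (nat \<Rightarrow> real ^ 'd \<Rightarrow> complex) \<Rightarrow> bool" where
  "form_approx V f fs \<longleftrightarrow>
     L2 f \<and> (\<forall>n. test_function (fs n)) \<and>
     (\<lambda>n. norm2 (\<lambda>x. fs n x - f x)) \<longlonglongrightarrow> 0 \<and>
     (\<forall>\<epsilon>>0. \<exists>N. \<forall>m\<ge>N. \<forall>n\<ge>N. \<bar>quad_form V (\<lambda>x. fs m x - fs n x)\<bar> < \<epsilon>)"

definition form_domain :: "(real ^ 'd \<Rightarrow> real) \<Rightarrow> (real ^ 'd \<Rightarrow> complex) \<Rightarrow> bool" where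
  "form_domain V f \<longleftrightarrow> (\<exists>fs. form_approx V f fs)"

text \<open>\<open>closed_form V f h c\<close>: the closed form takes the value \<open>c\<close> at \<open>(f, h)\<close>.\<close>

definition closed_form ::
    "(real ^ 'd \<Rightarrow> real) \<Rightarrow> (real ^ 'd \<Rightarrow> complex) \<Rightarrow> (real ^ 'd \<Rightarrow> complex) \<Rightarrow> complex \<Rightarrow> bool" where
  "closed_form V f h c \<longleftrightarrow>
     (\<exists>fs hs. form_approx V f fs \<and> form_approx V h hs \<and>
        (\<lambda>n. sesq_form V (fs n) (hs n)) \<longlonglongrightarrow> c)"

text \<open>The graph of the self-adjoint operator H associated with the closed form:
  \<open>schroedinger_op V f w\<close> says that \<open>f\<close> is in the domain of H and \<open>H f = w\<close>.\<close>

definition schroedinger_op ::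
    "(real ^ 'd \<Rightarrow> real) \<Rightarrow> (real ^ 'd \<Rightarrow> complex) \<Rightarrow> (real ^ 'd \<Rightarrow> complex) \<Rightarrow> bool" where
  "schroedinger_op V f w \<longleftrightarrow>
     form_domain V f \<and> L2 w \<and> (\<forall>h. form_domain V h \<longrightarrow> closed_form V h f (inner2 h w))"

text \<open>\<open>L2_expansion e c h\<close>: \<open>h\<close> is the sum in L2 of the family \<open>c m * e m\<close>.\<close>

definition L2_expansion ::
    "(nat ^ 'd \<Rightarrow> real ^ 'd \<Rightarrow> complex) \<Rightarrow> (nat ^ 'd \<Rightarrow> complex) \<Rightarrow> (real ^ 'd \<Rightarrow> complex) \<Rightarrow> bool" where
  "L2_expansion e c h \<longleftrightarrow> L2 h \<and>
     ((\<lambda>S. norm2 (\<lambda>x. h x - (\<Sum>m\<in>S. c m * e m x))) \<longlongrightarrow> 0) (finite_subsets_at_top UNIV)"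

text \<open>An orthonormal basis \<open>e\<close> of L2 consisting of eigenfunctions of H with eigenvalues \<open>E\<close>; thus
  \<open>E\<close> enumerates the whole spectrum of H with multiplicities. Such a basis exists because the
  resolvent is compact.\<close>

definition eigenbasis ::
    "(real ^ 'd \<Rightarrow> real) \<Rightarrow> (nat ^ 'd \<Rightarrow> real) \<Rightarrow> (nat ^ 'd \<Rightarrow> real ^ 'd \<Rightarrow> complex) \<Rightarrow> bool" where
  "eigenbasis V E e \<longleftrightarrow>
     (\<forall>m. schroedinger_op V (e m) (\<lambda>x. complex_of_real (E m) * e m x)) \<and>
     (\<forall>m n. inner2 (e m) (e n) = (if m = n then 1 else 0)) \<and>
     (\<forall>f. L2 f \<longrightarrow> L2_expansion e (\<lambda>m. inner2 (e m) f) f)"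

text \<open>\<open>heat_semigroup E e t f h\<close>: \<open>h = exp[-tH] f\<close>, the function \<open>exp(-t _)\<close> of the operator H
  being given by the spectral theorem for an operator with eigenbasis \<open>e\<close>.\<close>

definition heat_semigroup ::
    "(nat ^ 'd \<Rightarrow> real) \<Rightarrow> (nat ^ 'd \<Rightarrow> real ^ 'd \<Rightarrow> complex) \<Rightarrow> real \<Rightarrow>
     (real ^ 'd \<Rightarrow> complex) \<Rightarrow> (real ^ 'd \<Rightarrow> complex) \<Rightarrow> bool" where
  "heat_semigroup E e t f h \<longleftrightarrow>
     L2_expansion e (\<lambda>m. complex_of_real (exp (- t * E m)) * inner2 (e m) f) h"

definition green_function ::
    "real \<Rightarrow> (nat ^ 'd \<Rightarrow> real) \<Rightarrow> (nat ^ 'd \<Rightarrow> real ^ 'd \<Rightarrow> complex) \<Rightarrow>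
     (real ^ 'd \<Rightarrow> real \<Rightarrow> real ^ 'd \<Rightarrow> real) \<Rightarrow> bool" where
  "green_function T E e g \<longleftrightarrow>
     (\<forall>t\<in>{0<..T}. \<forall>f. L2 f \<longrightarrow>
        (AE x in lebesgue. integrable lebesgue (\<lambda>y. complex_of_real (g x t y) * f y)) \<and>
        heat_semigroup E e t f (\<lambda>x. LINT y|lebesgue. complex_of_real (g x t y) * f y)) \<and>
     continuous_on (UNIV \<times> {0<..T} \<times> UNIV) (\<lambda>(x, t, y). g x t y) \<and>
     (\<forall>x y. \<forall>t\<in>{0<..T}. g x t y > 0) \<and>
     (\<forall>x y. \<forall>t\<in>{0<..T}. g x t y = g y t x)"


section \<open>The measures and solutions attached to a pair of points\<close>

text \<open>\<open>scaled_dirac g T a b c\<close> is the measure written as the density \<open>\<delta>(x - c) / g^(1/2)(a,T,b)\<close>.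
  Integration against \<open>\<phi>(x) dx\<close> or \<open>\<psi>(x) dx\<close> is integration with respect to it.\<close>

definition scaled_dirac ::
    "(real ^ 'd \<Rightarrow> real \<Rightarrow> real ^ 'd \<Rightarrow> real) \<Rightarrow> real \<Rightarrow>
     real ^ 'd \<Rightarrow> real ^ 'd \<Rightarrow> real ^ 'd \<Rightarrow> (real ^ 'd) measure" where
  "scaled_dirac g T a b c = scale_measure (ennreal (1 / sqrt (g a T b))) (return borel c)"

definition phi0 ::
    "(real ^ 'd \<Rightarrow> real \<Rightarrow> real ^ 'd \<Rightarrow> real) \<Rightarrow> real \<Rightarrow>
     real ^ 'd \<Rightarrow> real ^ 'd \<Rightarrow> (real ^ 'd) measure" where
  "phi0 g T a b = scaled_dirac g T a b a"

definition psiT ::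
    "(real ^ 'd \<Rightarrow> real \<Rightarrow> real ^ 'd \<Rightarrow> real) \<Rightarrow> real \<Rightarrow>
     real ^ 'd \<Rightarrow> real ^ 'd \<Rightarrow> (real ^ 'd) measure" where
  "psiT g T a b = scaled_dirac g T a b b"

definition pair_law ::
    "(real ^ 'd \<Rightarrow> real \<Rightarrow> real ^ 'd \<Rightarrow> real) \<Rightarrow> real \<Rightarrow>
     real ^ 'd \<Rightarrow> real ^ 'd \<Rightarrow> ((real ^ 'd) \<times> (real ^ 'd)) measure" where
  "pair_law g T a b = density (phi0 g T a b \<Otimes>\<^sub>M psiT g T a b) (\<lambda>(x, y). ennreal (g x T y))"

definition forward_sol ::
    "(real ^ 'd \<Rightarrow> real \<Rightarrow> real ^ 'd \<Rightarrow> real) \<Rightarrow> real \<Rightarrow>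
     real ^ 'd \<Rightarrow> real ^ 'd \<Rightarrow> real ^ 'd \<Rightarrow> real \<Rightarrow> real" where
  "forward_sol g T a b x t = (LINT y|phi0 g T a b. g x t y)"

definition backward_sol ::
    "(real ^ 'd \<Rightarrow> real \<Rightarrow> real ^ 'd \<Rightarrow> real) \<Rightarrow> real \<Rightarrow>
     real ^ 'd \<Rightarrow> real ^ 'd \<Rightarrow> real ^ 'd \<Rightarrow> real \<Rightarrow> real" where
  "backward_sol g T a b x t = (LINT y|psiT g T a b. g x (T - t) y)"

text \<open>The mass that the mixture puts on the point \<open>(x, y)\<close> is the total weight of the indices whose
  pair of points is \<open>(x, y)\<close>. The predicate says that these masses have the form
  \<open>\<phi>(x) g(x,T,y) \<psi>(y)\<close>, with a single pair of functions. For example, this holds if all points \<open>a m\<close>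
  coincide. The process associated with the mixture is then Markovian, which is why this case has
  to be excluded when the mixture is claimed to be non-Markovian.\<close>

definition product_form ::
    "(real ^ 'd \<Rightarrow> real \<Rightarrow> real ^ 'd \<Rightarrow> real) \<Rightarrow> real \<Rightarrow> (nat ^ 'd \<Rightarrow> real) \<Rightarrow>
     (nat ^ 'd \<Rightarrow> real ^ 'd) \<Rightarrow> (nat ^ 'd \<Rightarrow> real ^ 'd) \<Rightarrow> bool" where
  "product_form g T p a b \<longleftrightarrow>
     (\<exists>\<phi> \<psi>. \<forall>x y. (\<Sum>\<^sub>\<infinity>m\<in>{m. a m = x \<and> b m = y}. p m) = \<phi> x * g x T y * \<psi> y)"

text \<open>The product form is excluded as soon as some crossed pair \<open>(a m, b n)\<close> is not among the
  chosen pairs, in particular if \<open>a\<close> and \<open>b\<close> are injective.\<close>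

lemma not_product_formI:
  assumes p: "\<And>m. p m > 0" "p summable_on UNIV"
    and g: "g (a m) T (b n) > 0"
    and ne: "\<And>k. (a k, b k) \<noteq> (a m, b n)"
  shows "\<not> product_form g T p a b"
proof
  assume "product_form g T p a b"
  then obtain \<phi> \<psi>
    where eq: "\<And>x y. (\<Sum>\<^sub>\<infinity>m\<in>{m. a m = x \<and> b m = y}. p m) = \<phi> x * g x T y * \<psi> y"
    unfolding product_form_def by blast
  have pos: "(\<Sum>\<^sub>\<infinity>j\<in>{j. a j = a k \<and> b j = b k}. p j) > 0" for k
  proof -
    have "p k = (\<Sum>\<^sub>\<infinity>j\<in>{k}. p j)" by simp
    also have "\<dots> \<le> (\<Sum>\<^sub>\<infinity>j\<in>{j. a j = a k \<and> b j = b k}. p j)"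
      using p by (intro infsum_mono2 summable_on_subset_banach[OF p(2)]) (auto intro: less_imp_le)
    finally show ?thesis using p(1)[of k] by linarith
  qed
  have empty: "{j. a j = a m \<and> b j = b n} = {}"
    using ne by auto
  have zero: "\<phi> (a m) * g (a m) T (b n) * \<psi> (b n) = 0"
    using eq[of "a m" "b n"] unfolding empty by simp
  have "\<phi> (a m) \<noteq> 0" "\<psi> (b n) \<noteq> 0"
    using pos[of m] pos[of n] eq[of "a m" "b m"] eq[of "a n" "b n"] by auto
  then show False
    using zero g by simp
qed


section \<open>Bernstein processes\<close>

definition sigma_gen ::
    "'w measure \<Rightarrow> (real \<Rightarrow> 'w \<Rightarrow> 'a::topological_space) \<Rightarrow> real set \<Rightarrow> 'w measure" where
  "sigma_gen M Z I = sigma (space M) {Z \<tau> -` F \<inter> space M | \<tau> F. \<tau> \<in> I \<and> F \<in> sets borel}"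

text \<open>The sigma-algebra generated by two sigma-algebras on the space of \<open>M\<close>.\<close>

definition sigma_join :: "'w measure \<Rightarrow> 'w measure \<Rightarrow> 'w measure \<Rightarrow> 'w measure" where
  "sigma_join M A B = sigma (space M) (sets A \<union> sets B)"

definition complex_cond_exp :: "'w measure \<Rightarrow> 'w measure \<Rightarrow> ('w \<Rightarrow> complex) \<Rightarrow> 'w \<Rightarrow> complex" where
  "complex_cond_exp M A X \<omega> =
     Complex (real_cond_exp M A (\<lambda>\<omega>. Re (X \<omega>)) \<omega>) (real_cond_exp M A (\<lambda>\<omega>. Im (X \<omega>)) \<omega>)"

definition process :: "real \<Rightarrow> 'w measure \<Rightarrow> (real \<Rightarrow> 'w \<Rightarrow> real ^ 'd) \<Rightarrow> bool" where
  "process T M Z \<longleftrightarrow>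
     prob_space M \<and> complete_measure M \<and> (\<forall>t\<in>{0..T}. Z t \<in> measurable M borel)"

definition bernstein_process :: "real \<Rightarrow> 'w measure \<Rightarrow> (real \<Rightarrow> 'w \<Rightarrow> real ^ 'd) \<Rightarrow> bool" where
  "bernstein_process T M Z \<longleftrightarrow> process T M Z \<and>
     (\<forall>b :: real ^ 'd \<Rightarrow> complex. b \<in> borel_measurable borel \<and> bounded (range b) \<longrightarrow>
       (\<forall>s r t. 0 \<le> s \<and> s < r \<and> r < t \<and> t \<le> T \<longrightarrow>
         (AE \<omega> in M.
            complex_cond_exp M (sigma_join M (sigma_gen M Z {0..s}) (sigma_gen M Z {t..T}))
              (\<lambda>\<omega>. b (Z r \<omega>)) \<omega>
            = complex_cond_exp M (sigma_gen M Z {s, t}) (\<lambda>\<omega>. b (Z r \<omega>)) \<omega>)))"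

definition markovian :: "real \<Rightarrow> 'w measure \<Rightarrow> (real \<Rightarrow> 'w \<Rightarrow> real ^ 'd) \<Rightarrow> bool" where
  "markovian T M Z \<longleftrightarrow>
     (\<forall>b :: real ^ 'd \<Rightarrow> complex. b \<in> borel_measurable borel \<and> bounded (range b) \<longrightarrow>
       (\<forall>s t. 0 \<le> s \<and> s < t \<and> t \<le> T \<longrightarrow>
         (AE \<omega> in M.
            complex_cond_exp M (sigma_gen M Z {0..s}) (\<lambda>\<omega>. b (Z t \<omega>)) \<omega>
            = complex_cond_exp M (sigma_gen M Z {s}) (\<lambda>\<omega>. b (Z t \<omega>)) \<omega>)))"

definition stationary :: "real \<Rightarrow> 'w measure \<Rightarrow> (real \<Rightarrow> 'w \<Rightarrow> real ^ 'd) \<Rightarrow> bool" where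
  "stationary T M Z \<longleftrightarrow>
     (\<forall>n\<ge>1. \<forall>(t :: nat \<Rightarrow> real) h F.
        strict_mono_on {1..n} t \<and>
        (\<forall>k\<in>{1..n}. t k \<in> {0..T} \<and> t k + h \<in> {0..T} \<and> F k \<in> sets borel) \<longrightarrow>
        measure M {\<omega> \<in> space M. \<forall>k\<in>{1..n}. Z (t k + h) \<omega> \<in> F k}
        = measure M {\<omega> \<in> space M. \<forall>k\<in>{1..n}. Z (t k) \<omega> \<in> F k})"

text \<open>The convention for times is \<open>0 = t 0 < t 1 < \<dots> < t n < t (n + 1) = T\<close>.\<close>

definition time_grid :: "real \<Rightarrow> nat \<Rightarrow> (nat \<Rightarrow> real) \<Rightarrow> bool" where
  "time_grid T n t \<longleftrightarrow> t 0 = 0 \<and> t (Suc n) = T \<and> (\<forall>k\<le>n. t k < t (Suc k))"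

text \<open>The integral over \<open>x 1 \<in> F 1, \<dots>, x n \<in> F n\<close>. All integrands below are nonnegative, so the
  iterated integral is the integral over the product.\<close>

definition box_integral ::
    "nat \<Rightarrow> (nat \<Rightarrow> (real ^ 'd) set) \<Rightarrow> ((nat \<Rightarrow> real ^ 'd) \<Rightarrow> real) \<Rightarrow> ennreal" where
  "box_integral n F f = (\<integral>\<^sup>+ X \<in> Pi\<^sub>E {1..n} F. ennreal (f X) \<partial>Pi\<^sub>M {1..n} (\<lambda>_. lborel))"

definition bernstein_process_of ::
    "real \<Rightarrow> (real ^ 'd \<Rightarrow> real \<Rightarrow> real ^ 'd \<Rightarrow> real) \<Rightarrow> ((real ^ 'd) \<times> (real ^ 'd)) measure \<Rightarrow>
     'w measure \<Rightarrow> (real \<Rightarrow> 'w \<Rightarrow> real ^ 'd) \<Rightarrow> bool" where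
  "bernstein_process_of T g \<mu> M Z \<longleftrightarrow> bernstein_process T M Z \<and>
     (\<forall>n\<ge>1. \<forall>t F F0 FT.
        time_grid T n t \<and> F0 \<in> sets borel \<and> FT \<in> sets borel \<and>
        (\<forall>k\<in>{1..n}. F k \<in> sets borel) \<longrightarrow>
        emeasure M {\<omega> \<in> space M. Z 0 \<omega> \<in> F0 \<and> (\<forall>k\<in>{1..n}. Z (t k) \<omega> \<in> F k) \<and> Z T \<omega> \<in> FT}
        = (\<integral>\<^sup>+ z \<in> F0 \<times> FT. (case z of (x, y) \<Rightarrow>
             box_integral n F (\<lambda>X. let X = X(0 := x) in
               (\<Prod>k=1..n. g (X k) (t k - t (k - 1)) (X (k - 1))) * g y (T - t n) (X n))
             / ennreal (g x T y)) \<partial>\<mu>))"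

end

theory Submission
  imports Defs
begin

text \<open>
  Since \<open>g\<close> appears in both the density of \<open>\<mu> m\<close> and the normalisation of the Dirac masses, \<open>\<mu> m\<close> is the
  point mass at \<open>(a m, b m)\<close> (\<open>pair_law_eq_return\<close>). Hence \<open>Z m\<close> is pinned: it starts at \<open>a m\<close>, ends at
  \<open>b m\<close>, and its laws at intermediate times have the density obtained by multiplying the kernels along
  the path and dividing by \<open>g (a m) T (b m)\<close>. The two formulas in terms of \<open>v\<close> and \<open>u\<close> are this density,
  written with telescoping ratios (\<open>bridge_prob_backward\<close>, \<open>bridge_prob_forward\<close>).

  The law of a Bernstein process is the integral of the pinned laws over the law of its endpoints.
  The measure \<open>\<mu>bar\<close> is a countable sum of point masses, so every probability for \<open>Zbar\<close> is the average
  of the probabilities for the \<open>Z m\<close> with weights \<open>p m\<close> (\<open>mixture_fdd\<close>), and likewise for expectations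
  (\<open>mixture_expectation\<close>).

  The mixture is not stationary because its law is atomic at time \<open>0\<close> and has a density at time \<open>T / 2\<close>
  (\<open>not_stationary\<close>). If it were Markovian, the endpoints would be conditionally independent given the
  position \<open>z\<close> at time \<open>T / 2\<close>. Evaluating the joint density at one suitable \<open>z\<close> then exhibits the masses
  of the pairs of endpoints as \<open>\<phi> x * g x T y * \<psi> y\<close> (\<open>markovian_imp_product\<close>).
\<close>

section \<open>Discrete mixtures of probability measures\<close>

lemma pmf_of_weights:
  fixes p :: "'i \<Rightarrow> real"
  assumes "\<And>m. 0 \<le> p m" and "(p has_sum 1) UNIV"
  obtains P where "\<And>m. pmf P m = p m"
proof
  have "(\<lambda>m. norm (p m)) summable_on UNIV"
    using assms by (simp add: has_sum_imp_summable)
  then have "Infinite_Set_Sum.abs_summable_on p UNIV"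
    by (simp only: abs_summable_equivalent)
  then have "(\<integral>\<^sup>+ m. ennreal (p m) \<partial>count_space UNIV) = 1"
    using assms by (simp add: nn_integral_conv_infsetsum infsetsum_infsum infsumI)
  then show "pmf (embed_pmf p) m = p m" for m
    using assms(1) by (simp add: pmf_embed_pmf)
qed

lemma has_sum_pmf_expectation:
  fixes h :: "'i \<Rightarrow> real"
  assumes "\<And>m. \<bar>h m\<bar> \<le> C"
  shows "((\<lambda>m. pmf P m * h m) has_sum measure_pmf.expectation P h) UNIV"
proof -
  have "integrable (measure_pmf P) h"
    using assms by (intro measure_pmf.integrable_const_bound[where B = C]) auto
  then have "Infinite_Set_Sum.abs_summable_on (\<lambda>m. pmf P m * h m) UNIV"
    by (simp add: measure_pmf_eq_density integrable_density abs_summable_on_def)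
  then have "(\<lambda>m. norm (pmf P m * h m)) summable_on UNIV"
    and exp: "measure_pmf.expectation P h = infsum (\<lambda>m. pmf P m * h m) UNIV"
    by (simp_all only: abs_summable_equivalent infsetsum_infsum pmf_expectation_eq_infsetsum)
  from this(1) show ?thesis
    unfolding exp by (rule has_sum_infsum[OF abs_summable_summable])
qed

text \<open>The mixture identity is first obtained as a Lebesgue integral over the index, whose
  values in \<open>[0, \<infinity>]\<close> always exist; this lemma turns it into an unconditional sum of real numbers.\<close>

lemma mixture_has_sum:
  assumes "prob_space N" and "\<And>m. prob_space (K m)"
    and eq: "emeasure N A = (\<integral>\<^sup>+ m. emeasure (K m) (B m) \<partial>measure_pmf P)"
  shows "((\<lambda>m. pmf P m * measure (K m) (B m)) has_sum measure N A) UNIV"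
proof -
  interpret N: prob_space N by fact
  have K: "emeasure (K m) (B m) = ennreal (measure (K m) (B m))" for m
    using assms(2) by (simp add: finite_measure.emeasure_eq_measure prob_space.finite_measure)
  have le1: "measure (K m) (B m) \<le> 1" for m
    using assms(2) by (simp add: prob_space.prob_le_1)
  have "ennreal (measure N A) = (\<integral>\<^sup>+ m. ennreal (measure (K m) (B m)) \<partial>measure_pmf P)"
    using eq K by (simp add: N.emeasure_eq_measure)
  also have "\<dots> = ennreal (measure_pmf.expectation P (\<lambda>m. measure (K m) (B m)))"
    using le1 by (intro nn_integral_eq_integral measure_pmf.integrable_const_bound[where B = 1]) auto
  finally have "measure N A = measure_pmf.expectation P (\<lambda>m. measure (K m) (B m))"
    by (simp add: integral_nonneg_AE)
  then show ?thesis
    using has_sum_pmf_expectation[where C = 1 and h = "\<lambda>m. measure (K m) (B m)" and P = P] le1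
    by simp
qed

text \<open>An identity between measures of events becomes an identity between expectations because the
  mixture is the monadic bind of the index distribution with the family of its components.\<close>

lemma mixture_expectation_real:
  fixes f :: "'b \<Rightarrow> real"
  assumes N: "prob_space N" "sets N = sets L"
    and K: "\<And>m. prob_space (K m)" "\<And>m. sets (K m) = sets L"
    and eq: "\<And>A. A \<in> sets L \<Longrightarrow> emeasure N A = (\<integral>\<^sup>+ m. emeasure (K m) A \<partial>measure_pmf P)"
    and f: "f \<in> borel_measurable L" "\<And>x. \<bar>f x\<bar> \<le> C"
  shows "((\<lambda>m. pmf P m * (LINT x|K m. f x)) has_sum (LINT x|N. f x)) UNIV"
proof -
  have kernel: "K \<in> measurable (measure_pmf P) (subprob_algebra L)"
    using K by (auto simp: measurable_pmf_measure1 space_subprob_algebra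
        intro: prob_space_imp_subprob_space)
  have N_bind: "N = measure_pmf P \<bind> K"
    using kernel eq N(2)
    by (intro measure_eqI) (auto simp: emeasure_bind[where N = L] sets_bind[OF subprob_measurableD(2)[OF kernel]])
  have "(LINT x|N. f x) = measure_pmf.expectation P (\<lambda>m. LINT x|K m. f x)"
    unfolding N_bind
    by (rule integral_bind[where K = L and B = C and B' = 1])
      (use f kernel K in \<open>auto simp: measure_pmf.finite_measure_axioms prob_space.emeasure_space_1\<close>)
  moreover have "\<bar>LINT x|K m. f x\<bar> \<le> C" for m
  proof -
    interpret prob_space "K m" by fact
    have "integrable (K m) f"
      using f K(2) by (intro integrable_const_bound[where B = C]) (auto cong: measurable_cong_sets)
    then have "(LINT x|K m. f x) \<le> C" "- C \<le> (LINT x|K m. f x)"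
      using f(2) by (auto intro!: integral_le_const integral_ge_const simp: abs_le_iff minus_le_iff)
    then show ?thesis by simp
  qed
  ultimately show ?thesis
    using has_sum_pmf_expectation[of "\<lambda>m. LINT x|K m. f x" C P] by simp
qed

lemma mixture_expectation:
  fixes f :: "'b \<Rightarrow> complex"
  assumes N: "prob_space N" "sets N = sets L"
    and K: "\<And>m. prob_space (K m)" "\<And>m. sets (K m) = sets L"
    and eq: "\<And>A. A \<in> sets L \<Longrightarrow> emeasure N A = (\<integral>\<^sup>+ m. emeasure (K m) A \<partial>measure_pmf P)"
    and f: "f \<in> borel_measurable L" "\<And>x. cmod (f x) \<le> C"
  shows "((\<lambda>m. complex_of_real (pmf P m) * (LINT x|K m. f x)) has_sum (LINT x|N. f x)) UNIV"
proof -
  have parts: "(LINT x|Q. f x) = Complex (LINT x|Q. Re (f x)) (LINT x|Q. Im (f x))"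
    if "prob_space Q" "sets Q = sets L" for Q
  proof -
    interpret Q: prob_space Q by fact
    have "f \<in> borel_measurable Q"
      using f(1) by (simp only: measurable_cong_sets[OF that(2) refl])
    then have "integrable Q f"
      using f(2) by (intro Q.integrable_const_bound[where B = C]) simp_all
    then show ?thesis
      by (intro complex_eqI) simp_all
  qed
  have "((\<lambda>m. pmf P m * (LINT x|K m. Re (f x))) has_sum (LINT x|N. Re (f x))) UNIV"
    by (rule mixture_expectation_real[OF N K eq, where C = C])
      (use f in \<open>simp_all add: order_trans[OF abs_Re_le_cmod]\<close>)
  moreover have "((\<lambda>m. pmf P m * (LINT x|K m. Im (f x))) has_sum (LINT x|N. Im (f x))) UNIV"
    by (rule mixture_expectation_real[OF N K eq, where C = C])
      (use f in \<open>simp_all add: order_trans[OF abs_Im_le_cmod]\<close>)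
  ultimately have "((\<lambda>m. complex_of_real (pmf P m * (LINT x|K m. Re (f x)))
      + \<i> * complex_of_real (pmf P m * (LINT x|K m. Im (f x))))
      has_sum complex_of_real (LINT x|N. Re (f x)) + \<i> * complex_of_real (LINT x|N. Im (f x))) UNIV"
    by (intro has_sum_add has_sum_cmult_right has_sum_of_real)
  then show ?thesis
    unfolding parts[OF N] parts[OF K] Complex_eq by (simp add: algebra_simps)
qed

section \<open>The Markov property and factorisation through the present\<close>

text \<open>The Doob-Dynkin lemma: a function measurable for the sigma-algebra generated by \<open>f\<close> is a function
  of \<open>f\<close>. With values in \<open>[0, \<infinity>]\<close> it follows by induction over the construction of measurable
  functions, since the supremum of the factors always exists there.\<close>

lemma factor_through_vimage_algebra:
  fixes h :: "'b \<Rightarrow> ennreal"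
  assumes f: "f \<in> X \<rightarrow> space N" and h: "h \<in> borel_measurable (vimage_algebra X f N)"
  shows "\<exists>k\<in>borel_measurable N. \<forall>x\<in>X. h x = k (f x)"
  using h
proof (induction rule: borel_measurable_induct)
  case (cong u v)
  then show ?case by simp
next
  case (set A)
  then obtain B where "B \<in> sets N" "A = f -` B \<inter> X"
    using f by (auto simp: sets_vimage_algebra2)
  then show ?case
    by (intro bexI[of _ "indicator B"]) (auto simp: indicator_def)
next
  case (mult u c)
  then obtain k where "k \<in> borel_measurable N" "\<forall>x\<in>X. u x = k (f x)" by blast
  then show ?case by (intro bexI[of _ "\<lambda>y. c * k y"]) auto
next
  case (add u v)
  then obtain k k' where "k \<in> borel_measurable N" "\<forall>x\<in>X. u x = k (f x)"
    "k' \<in> borel_measurable N" "\<forall>x\<in>X. v x = k' (f x)" by blast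
  then show ?case by (intro bexI[of _ "\<lambda>y. k' y + k y"]) auto
next
  case (seq U)
  then obtain k where "\<And>i. k i \<in> borel_measurable N" "\<And>i. \<forall>x\<in>X. U i x = k i (f x)" by metis
  then show ?case
    by (intro bexI[of _ "\<lambda>y. SUP i. k i y"]) (auto simp: image_comp)
qed

lemma subalgebra_sigma_gen:
  assumes "process T M Z" and "I \<subseteq> {0..T}"
  shows "subalgebra M (sigma_gen M Z I)"
proof -
  have "{Z \<tau> -` F \<inter> space M | \<tau> F. \<tau> \<in> I \<and> F \<in> sets borel} \<subseteq> sets M"
    using assms by (auto simp: process_def intro!: measurable_sets)
  then have "sigma_sets (space M) {Z \<tau> -` F \<inter> space M | \<tau> F. \<tau> \<in> I \<and> F \<in> sets borel} \<subseteq> sets M"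
    by (rule sets.sigma_sets_subset)
  moreover have "{Z \<tau> -` F \<inter> space M | \<tau> F. \<tau> \<in> I \<and> F \<in> sets borel} \<subseteq> Pow (space M)"
    by blast
  ultimately show ?thesis
    by (simp add: subalgebra_def sigma_gen_def)
qed

lemma in_sigma_gen:
  assumes "\<tau> \<in> I" "F \<in> sets borel"
  shows "{\<omega> \<in> space M. Z \<tau> \<omega> \<in> F} \<in> sets (sigma_gen M Z I)"
proof -
  have "{\<omega> \<in> space M. Z \<tau> \<omega> \<in> F} = Z \<tau> -` F \<inter> space M" by blast
  then show ?thesis
    unfolding sigma_gen_def using assms by (subst sets_measure_of) (auto intro: sigma_sets.Basic)
qed

lemma sets_sigma_gen_single: "sets (sigma_gen M Z {s}) = sets (vimage_algebra (space M) (Z s) borel)"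
proof -
  have "{Z \<tau> -` F \<inter> space M | \<tau> F. \<tau> \<in> {s} \<and> F \<in> sets borel}
      = {Z s -` F \<inter> space M | F. F \<in> sets borel}" by blast
  then show ?thesis
    unfolding sigma_gen_def sets_vimage_algebra by (subst sets_measure_of) auto
qed

text \<open>The form in which the Markov property is used. The conditional probability of \<open>Z t \<in> B\<close> given the
  past up to \<open>s\<close> agrees with the one given \<open>Z s\<close>; the latter is a Borel function \<open>k\<close> of \<open>Z s\<close> by the
  Doob-Dynkin lemma, so the defining identity over events of the past can be written with \<open>k\<close>.\<close>

lemma markovian_transition:
  fixes Z :: "real \<Rightarrow> 'w \<Rightarrow> real ^ 'd"
  assumes proc: "process T M Z" and markov: "markovian T M Z"
    and st: "0 \<le> s" "s < t" "t \<le> T" and B: "B \<in> sets borel"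
  shows "\<exists>k\<in>borel_measurable borel. \<forall>A\<in>sets (sigma_gen M Z {0..s}).
    emeasure M {\<omega> \<in> A. Z t \<omega> \<in> B} = (\<integral>\<^sup>+ \<omega> \<in> A. k (Z s \<omega>) \<partial>M)"
proof -
  interpret prob_space M using proc by (simp add: process_def)
  have [measurable]: "Z t \<in> measurable M borel" and B' [measurable]: "B \<in> sets borel"
    using proc st B by (auto simp: process_def)
  define past where "past = sigma_gen M Z {0..s}"
  define present where "present = sigma_gen M Z {s}"
  have sub: "subalgebra M past" "subalgebra M present"
    unfolding past_def present_def using proc st by (auto intro!: subalgebra_sigma_gen)
  interpret past: finite_measure_subalgebra M past by standard fact
  interpret present: finite_measure_subalgebra M present by standard fact
  define f where "f \<omega> = indicat_real B (Z t \<omega>)" for \<omega>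
  have [measurable]: "f \<in> borel_measurable M" unfolding f_def by measurable
  have int_f: "integrable M f"
    by (rule integrable_const_bound[where B = 1]) (auto simp: f_def)
  have "bounded (range (\<lambda>x. complex_of_real (indicat_real B x)))"
    by (rule boundedI[where B = 1]) (auto simp: indicator_def)
  moreover have "(\<lambda>x. complex_of_real (indicat_real B x)) \<in> borel_measurable borel"
    by measurable
  ultimately have "AE \<omega> in M. complex_cond_exp M past (\<lambda>\<omega>. complex_of_real (f \<omega>)) \<omega>
      = complex_cond_exp M present (\<lambda>\<omega>. complex_of_real (f \<omega>)) \<omega>"
    using markov st unfolding markovian_def past_def present_def f_def by blast
  then have same: "AE \<omega> in M. real_cond_exp M past f \<omega> = real_cond_exp M present f \<omega>"
    by (simp add: complex_cond_exp_def)
  have "(\<lambda>\<omega>. ennreal (real_cond_exp M present f \<omega>)) \<in> borel_measurable present"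
    by measurable
  then have "(\<lambda>\<omega>. ennreal (real_cond_exp M present f \<omega>))
      \<in> borel_measurable (vimage_algebra (space M) (Z s) borel)"
    unfolding present_def using measurable_cong_sets[OF sets_sigma_gen_single[of M Z s] refl] by blast
  then have "\<exists>k\<in>borel_measurable borel. \<forall>\<omega>\<in>space M.
      ennreal (real_cond_exp M present f \<omega>) = k (Z s \<omega>)"
    by (intro factor_through_vimage_algebra) simp
  then obtain k where k: "k \<in> borel_measurable borel"
    "\<And>\<omega>. \<omega> \<in> space M \<Longrightarrow> ennreal (real_cond_exp M present f \<omega>) = k (Z s \<omega>)"
    by blast
  show ?thesis
  proof (intro bexI[OF _ k(1)] ballI)
    fix A assume "A \<in> sets (sigma_gen M Z {0..s})"
    then have A: "A \<in> sets past" by (simp add: past_def)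
    then have [measurable]: "A \<in> sets M" using sub by (auto simp: subalgebra_def)
    have pos: "AE \<omega> in M. 0 \<le> real_cond_exp M past f \<omega>"
      by (rule past.real_cond_exp_pos) (auto simp: f_def)
    have "{\<omega> \<in> A. Z t \<omega> \<in> B} = {\<omega> \<in> space M. \<omega> \<in> A \<and> Z t \<omega> \<in> B}"
      using sets.sets_into_space[OF \<open>A \<in> sets M\<close>] by auto
    then have "emeasure M {\<omega> \<in> A. Z t \<omega> \<in> B}
        = (\<integral>\<^sup>+ \<omega>. indicator {\<omega> \<in> space M. \<omega> \<in> A \<and> Z t \<omega> \<in> B} \<omega> \<partial>M)"
      by simp
    also have "\<dots> = (\<integral>\<^sup>+ \<omega>. ennreal (indicator A \<omega> * f \<omega>) \<partial>M)"
      by (intro nn_integral_cong) (auto simp: f_def indicator_def)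
    also have "\<dots> = ennreal (\<integral> \<omega>. indicator A \<omega> * f \<omega> \<partial>M)"
      using integrable_mult_indicator[OF \<open>A \<in> sets M\<close> int_f]
      by (intro nn_integral_eq_integral) (auto simp: f_def)
    also have "(\<integral> \<omega>. indicator A \<omega> * f \<omega> \<partial>M) = (\<integral> \<omega>. indicator A \<omega> * real_cond_exp M past f \<omega> \<partial>M)"
      using past.real_cond_exp_intA[OF int_f A] by (simp add: set_lebesgue_integral_def)
    also have "ennreal \<dots> = (\<integral>\<^sup>+ \<omega>. ennreal (indicator A \<omega> * real_cond_exp M past f \<omega>) \<partial>M)"
      using integrable_mult_indicator[OF \<open>A \<in> sets M\<close> past.real_cond_exp_int(1)[OF int_f]] pos
      by (intro nn_integral_eq_integral[symmetric]) (auto elim: eventually_mono)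
    also have "\<dots> = (\<integral>\<^sup>+ \<omega> \<in> A. k (Z s \<omega>) \<partial>M)"
    proof (rule nn_integral_cong_AE)
      show "AE \<omega> in M. ennreal (indicator A \<omega> * real_cond_exp M past f \<omega>)
          = k (Z s \<omega>) * indicator A \<omega>"
        using same by eventually_elim (auto simp: indicator_def k(2)[symmetric] dest: sets.sets_into_space[OF \<open>A \<in> sets M\<close>, THEN subsetD])
    qed
    finally show "emeasure M {\<omega> \<in> A. Z t \<omega> \<in> B} = (\<integral>\<^sup>+ \<omega> \<in> A. k (Z s \<omega>) \<partial>M)" .
  qed
qed

section \<open>Point masses and time grids\<close>

text \<open>An arbitrary integrand may be replaced by its value at the atom almost everywhere. In this form the
  lemma applies to box integrals as functions of the endpoints.\<close>

lemma nn_integral_point_mass: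
  assumes x: "{x} \<in> sets N" and null: "emeasure N (space N - {x}) = 0"
  shows "(\<integral>\<^sup>+ z. f z \<partial>N) = f x * emeasure N {x}"
proof -
  have "AE z in N. z = x"
    using x null by (intro AE_I[where N = "space N - {x}"]) auto
  then have "(\<integral>\<^sup>+ z. f z \<partial>N) = (\<integral>\<^sup>+ z. f x * indicator {x} z \<partial>N)"
    by (intro nn_integral_cong_AE) (auto elim: eventually_mono)
  then show ?thesis
    using x by (simp add: nn_integral_cmult_indicator)
qed

text \<open>Transformation formula for arbitrary integrands: the image law lives on a countable set, outside
  of which the integrand may be set to zero, and this makes it measurable.\<close>

lemma nn_integral_distr_pmf:
  fixes c :: "'i::countable \<Rightarrow> 'b"
  assumes sing: "\<And>m. {c m} \<in> sets L"
  shows "(\<integral>\<^sup>+ z. f z \<partial>distr (measure_pmf P) L c) = (\<integral>\<^sup>+ m. f (c m) \<partial>measure_pmf P)"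
proof -
  have c: "c \<in> measurable (measure_pmf P) L"
    using sets.sets_into_space[OF sing] by (auto simp: measurable_pmf_measure1)
  have range: "range c \<in> sets L"
    using sets.countable[of "range c" L] sing by auto
  define f' where "f' z = (if z \<in> range c then f z else 0)" for z
  have "f' \<in> borel_measurable L"
    by (rule measurable_discrete_difference[where f = "\<lambda>_. 0" and X = "range c"])
      (use sing in \<open>auto simp: f'_def\<close>)
  moreover have "AE z in distr (measure_pmf P) L c. f z = f' z"
  proof -
    have "AE z in distr (measure_pmf P) L c. z \<in> range c"
      using range by (subst AE_distr_iff[OF c]) (auto simp: Collect_conj_eq[symmetric] sets.Int_space_eq1)
    then show ?thesis by eventually_elim (simp add: f'_def)
  qed
  ultimately show ?thesis
    using nn_integral_cong_AE[of f f'] nn_integral_distr[OF c, of f'] by (simp add: f'_def)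
qed

lemma time_grid_bounds:
  assumes grid: "time_grid T n t" and k: "k \<le> n"
  shows "0 \<le> t k" "t k < T" "0 < t (Suc k)" "t (Suc k) \<le> T" "0 < t (Suc k) - t k" "t (Suc k) - t k \<le> T"
proof -
  have step: "t i < t (Suc i)" if "i \<le> n" for i
    using grid that by (simp add: time_grid_def)
  have nonneg: "0 \<le> t i" if "i \<le> Suc n" for i
    using that
  proof (induction i)
    case 0
    then show ?case using grid by (simp add: time_grid_def)
  next
    case (Suc i)
    then show ?case using step[of i] by simp
  qed
  have le: "t i \<le> T" if "i \<le> Suc n" for i
    using that
  proof (induction rule: inc_induct)
    case base
    then show ?case using grid by (simp add: time_grid_def)
  next
    case (step i)
    then show ?case using \<open>\<And>i. i \<le> n \<Longrightarrow> t i < t (Suc i)\<close>[of i] by simp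
  qed
  show "0 \<le> t k" "t k < T" "0 < t (Suc k)" "t (Suc k) \<le> T" "0 < t (Suc k) - t k" "t (Suc k) - t k \<le> T"
    using nonneg[of k] le[of "Suc k"] step[OF k] k by auto
qed

lemma emeasure_scaled_dirac:
  assumes "A \<in> sets borel"
  shows "emeasure (scaled_dirac g T a b c) A = ennreal (1 / sqrt (g a T b)) * indicator A c"
  using assms by (simp add: scaled_dirac_def)

lemma nn_integral_scaled_dirac:
  "(\<integral>\<^sup>+ z. f z \<partial>scaled_dirac g T a b c) = f c * ennreal (1 / sqrt (g a T b))"
proof -
  have [simp]: "sets (scaled_dirac g T a b c) = sets borel" "space (scaled_dirac g T a b c) = UNIV"
    by (auto simp: scaled_dirac_def space_scale_measure)
  show ?thesis
    by (subst nn_integral_point_mass[where x = c]) (simp_all add: emeasure_scaled_dirac)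
qed

lemma prod_ratio_telescope_down:
  fixes w :: "nat \<Rightarrow> real"
  assumes "1 \<le> n" and "\<And>k. k \<le> n \<Longrightarrow> w (Suc k) \<noteq> 0"
  shows "(\<Prod>k=1..n. w k / w (Suc k)) = w 1 / w (Suc n)"
  using assms by (induction n rule: nat_induct_at_least) auto

section \<open>Bernstein processes pinned at both ends\<close>

locale positive_kernel =
  fixes T :: real and g :: "real ^ 'd \<Rightarrow> real \<Rightarrow> real ^ 'd \<Rightarrow> real"
  assumes T_pos: "0 < T"
    and continuous: "continuous_on (UNIV \<times> {0<..T} \<times> UNIV) (\<lambda>(x, t, y). g x t y)"
    and positive: "\<And>x y t. t \<in> {0<..T} \<Longrightarrow> 0 < g x t y"
    and symmetric: "\<And>x y t. t \<in> {0<..T} \<Longrightarrow> g x t y = g y t x"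
begin

lemma measurable_kernel:
  assumes t: "t \<in> {0<..T}" and [measurable]: "f \<in> borel_measurable N" "h \<in> borel_measurable N"
  shows "(\<lambda>\<omega>. g (f \<omega>) t (h \<omega>)) \<in> borel_measurable N"
proof -
  have "continuous_on UNIV (\<lambda>z. case (fst z, t, snd z) of (x, t, y) \<Rightarrow> g x t y)"
    by (rule continuous_on_compose2[OF continuous]) (use t in \<open>auto intro!: continuous_intros\<close>)
  then have "(\<lambda>z. g (fst z) t (snd z)) \<in> borel_measurable (borel \<Otimes>\<^sub>M borel)"
    unfolding borel_prod by (intro borel_measurable_continuous_onI) simp
  from measurable_compose[OF _ this, of "\<lambda>\<omega>. (f \<omega>, h \<omega>)" N] show ?thesis by simp
qed

lemma integral_scaled_dirac:
  assumes "f \<in> borel_measurable borel" "\<And>z. 0 \<le> f z"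
  shows "(LINT z|scaled_dirac g T a b c. f z) = f c / sqrt (g a T b)"
proof -
  have "f \<in> borel_measurable (scaled_dirac g T a b c)"
    using assms by (simp add: scaled_dirac_def measurable_def space_scale_measure)
  moreover have "0 \<le> g a T b"
    using positive[of T a b] T_pos by auto
  ultimately show ?thesis
    using assms by (simp add: integral_eq_nn_integral nn_integral_scaled_dirac ennreal_mult[symmetric])
qed

lemma forward_sol_eq:
  assumes "t \<in> {0<..T}"
  shows "forward_sol g T a b x t = g x t a / sqrt (g a T b)"
  unfolding forward_sol_def phi0_def using assms positive[OF assms]
  by (intro integral_scaled_dirac measurable_kernel) (auto simp: less_imp_le)

lemma backward_sol_eq:
  assumes "t \<in> {0..<T}"
  shows "backward_sol g T a b x t = g x (T - t) b / sqrt (g a T b)"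
  unfolding backward_sol_def psiT_def using assms positive[of "T - t"]
  by (intro integral_scaled_dirac measurable_kernel) (auto simp: less_imp_le)

text \<open>The two factors \<open>1 / sqrt (g a T b)\<close> cancel against the density, so this law fixes both endpoints.\<close>

lemma pair_law_eq_return: "pair_law g T a b = return (borel \<Otimes>\<^sub>M borel) (a, b)"
proof (rule measure_eqI)
  show sets: "sets (pair_law g T a b) = sets (return (borel \<Otimes>\<^sub>M borel) (a, b))"
    by (simp add: pair_law_def phi0_def psiT_def scaled_dirac_def cong: sets_pair_measure_cong)
  fix A assume "A \<in> sets (pair_law g T a b)"
  then have A[measurable]: "A \<in> sets (borel \<Otimes>\<^sub>M borel)"
    using sets by simp
  have gT: "0 < g a T b"
    using T_pos by (intro positive) auto
  have sets_dirac [measurable_cong]: "sets (scaled_dirac g T a b c) = sets borel" for c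
    by (simp add: scaled_dirac_def)
  have "finite_measure (scaled_dirac g T a b c)" for c
    by (rule finite_measureI)
      (simp add: emeasure_scaled_dirac sets_eq_imp_space_eq[OF sets_dirac] ennreal_mult_eq_top_iff)
  then interpret psi: finite_measure "scaled_dirac g T a b b" .
  have [measurable]: "(\<lambda>(x, y). ennreal (g x T y)) \<in> borel_measurable (borel \<Otimes>\<^sub>M borel)"
    using measurable_kernel[of T fst "borel \<Otimes>\<^sub>M borel" snd] T_pos by (simp add: case_prod_beta')
  have "emeasure (pair_law g T a b) A = (\<integral>\<^sup>+ z. (case z of (x, y) \<Rightarrow> ennreal (g x T y)) * indicator A z
      \<partial>(scaled_dirac g T a b a \<Otimes>\<^sub>M scaled_dirac g T a b b))"
    unfolding pair_law_def phi0_def psiT_def by (rule emeasure_density) measurable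
  also have "\<dots> = (\<integral>\<^sup>+ x. \<integral>\<^sup>+ y. ennreal (g x T y) * indicator A (x, y)
      \<partial>scaled_dirac g T a b b \<partial>scaled_dirac g T a b a)"
    by (subst psi.nn_integral_fst[symmetric]) auto
  also have "\<dots> = indicator A (a, b) * (ennreal (g a T b) * ennreal (1 / sqrt (g a T b)) * ennreal (1 / sqrt (g a T b)))"
    by (simp add: nn_integral_scaled_dirac mult_ac)
  also have "ennreal (g a T b) * ennreal (1 / sqrt (g a T b)) * ennreal (1 / sqrt (g a T b))
      = ennreal (g a T b * (1 / sqrt (g a T b)) * (1 / sqrt (g a T b)))"
  proof -
    have "ennreal r * ennreal q * ennreal q = ennreal (r * q * q)" if "0 \<le> r" "0 \<le> q" for r q
      using that by (simp add: ennreal_mult)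
    then show ?thesis using gT by simp
  qed
  also have "g a T b * (1 / sqrt (g a T b)) * (1 / sqrt (g a T b)) = 1"
    using gT by (simp add: field_simps)
  finally show "emeasure (pair_law g T a b) A = emeasure (return (borel \<Otimes>\<^sub>M borel) (a, b)) A"
    by simp
qed

text \<open>The unnormalised joint density of the positions at the times \<open>t 1, \<dots>, t n\<close> of a path from \<open>x\<close>
  to \<open>y\<close>; dividing by \<open>g x T y\<close> gives their density conditioned on the endpoints.\<close>

definition bridge_integrand ::
    "nat \<Rightarrow> (nat \<Rightarrow> real) \<Rightarrow> real ^ 'd \<Rightarrow> real ^ 'd \<Rightarrow> (nat \<Rightarrow> real ^ 'd) \<Rightarrow> real" where
  "bridge_integrand n t x y = (\<lambda>X. let X = X(0 := x) in
     (\<Prod>k=1..n. g (X k) (t k - t (k - 1)) (X (k - 1))) * g y (T - t n) (X n))"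

definition bridge_prob ::
    "nat \<Rightarrow> (nat \<Rightarrow> real) \<Rightarrow> (nat \<Rightarrow> (real ^ 'd) set) \<Rightarrow> real ^ 'd \<Rightarrow> real ^ 'd \<Rightarrow> ennreal" where
  "bridge_prob n t F x y = box_integral n F (bridge_integrand n t x y) / ennreal (g x T y)"

lemma bernstein_fdd:
  assumes "bernstein_process_of T g \<mu> M Z" and "1 \<le> n" "time_grid T n t"
    and "F0 \<in> sets borel" "FT \<in> sets borel" "\<forall>k\<in>{1..n}. F k \<in> sets borel"
  shows "emeasure M {\<omega> \<in> space M. Z 0 \<omega> \<in> F0 \<and> (\<forall>k\<in>{1..n}. Z (t k) \<omega> \<in> F k) \<and> Z T \<omega> \<in> FT}
    = (\<integral>\<^sup>+ z \<in> F0 \<times> FT. bridge_prob n t F (fst z) (snd z) \<partial>\<mu>)"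
  using assms unfolding bernstein_process_of_def bridge_prob_def bridge_integrand_def case_prod_beta'
  by blast

lemma pinned_fdd:
  assumes "bernstein_process_of T g (pair_law g T x y) M Z" and "1 \<le> n" "time_grid T n t"
    and "F0 \<in> sets borel" "FT \<in> sets borel" "\<forall>k\<in>{1..n}. F k \<in> sets borel"
  shows "emeasure M {\<omega> \<in> space M. Z 0 \<omega> \<in> F0 \<and> (\<forall>k\<in>{1..n}. Z (t k) \<omega> \<in> F k) \<and> Z T \<omega> \<in> FT}
    = bridge_prob n t F x y * indicator (F0 \<times> FT) (x, y)"
proof -
  have "{(x, y)} = {x} \<times> {y}" by simp
  then have "{(x, y)} \<in> sets (borel \<Otimes>\<^sub>M borel)"
    by (simp only:) (intro pair_measureI, auto)
  then show ?thesis
    unfolding bernstein_fdd[OF assms] pair_law_eq_return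
    by (subst nn_integral_point_mass[where x = "(x, y)"]) auto
qed

text \<open>Finite-dimensional laws depend on the law of the endpoints by integration of the pinned
  probabilities, so they inherit its decomposition into point masses. Keeping the endpoint events in
  the statement also covers the times \<open>0\<close> and \<open>T\<close>.\<close>

lemma mixture_fdd:
  fixes a b :: "'i::countable \<Rightarrow> real ^ 'd"
  assumes M: "\<And>m. bernstein_process_of T g (pair_law g T (a m) (b m)) (M m) (Z m)"
    and N: "bernstein_process_of T g (distr (measure_pmf P) (borel \<Otimes>\<^sub>M borel) (\<lambda>m. (a m, b m))) N W"
    and ev: "1 \<le> n" "time_grid T n t"
      "F0 \<in> sets borel" "FT \<in> sets borel" "\<forall>k\<in>{1..n}. F k \<in> sets borel"
  shows "emeasure N {\<omega> \<in> space N. W 0 \<omega> \<in> F0 \<and> (\<forall>k\<in>{1..n}. W (t k) \<omega> \<in> F k) \<and> W T \<omega> \<in> FT}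
    = (\<integral>\<^sup>+ m. emeasure (M m) {\<omega> \<in> space (M m).
         Z m 0 \<omega> \<in> F0 \<and> (\<forall>k\<in>{1..n}. Z m (t k) \<omega> \<in> F k) \<and> Z m T \<omega> \<in> FT} \<partial>measure_pmf P)"
proof -
  have "{(a m, b m)} \<in> sets (borel \<Otimes>\<^sub>M borel)" for m
  proof -
    have "{(a m, b m)} = {a m} \<times> {b m}" by simp
    then show ?thesis by (simp only:) (intro pair_measureI, auto)
  qed
  then show ?thesis
    unfolding bernstein_fdd[OF N ev] pinned_fdd[OF M ev] by (subst nn_integral_distr_pmf) auto
qed

lemma measurable_bridge_integrand:
  assumes n: "1 \<le> n" and grid: "time_grid T n t"
  shows "bridge_integrand n t x y \<in> borel_measurable (Pi\<^sub>M {1..n} (\<lambda>_. lborel))"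
proof -
  have coord: "(\<lambda>X. (X(0 := x)) k) \<in> borel_measurable (Pi\<^sub>M {1..n} (\<lambda>_. lborel))" if "k \<le> n" for k
    using that measurable_component_singleton[of k "{1..n}" "\<lambda>_. lborel"] by (cases "k = 0") auto
  have "t k - t (k - 1) \<in> {0<..T}" if "k \<in> {1..n}" for k
    using time_grid_bounds(5,6)[OF grid, of "k - 1"] that by auto
  moreover have "T - t n \<in> {0<..T}"
    using time_grid_bounds(1,2)[OF grid, of n] by auto
  ultimately show ?thesis
    unfolding bridge_integrand_def Let_def
    by (intro borel_measurable_times borel_measurable_prod measurable_kernel coord) auto
qed

lemma bridge_prob_eq_box_integral:
  assumes n: "1 \<le> n" and grid: "time_grid T n t" and F: "\<forall>k\<in>{1..n}. F k \<in> sets borel"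
  shows "bridge_prob n t F x y = box_integral n F (\<lambda>X. bridge_integrand n t x y X / g x T y)"
proof -
  have gT: "0 < g x T y"
    using T_pos by (intro positive) auto
  have "Pi\<^sub>E {1..n} F \<in> sets (Pi\<^sub>M {1..n} (\<lambda>_. lborel))"
    using F by (intro sets_PiM_I_finite) auto
  note [measurable] = this measurable_bridge_integrand[OF n grid, of x y]
  have split: "ennreal (r / g x T y) = ennreal r / ennreal (g x T y)" for r
    using gT ennreal_mult''[of "1 / g x T y" r]
    by (simp add: divide_ennreal_def inverse_ennreal inverse_eq_divide)
  have "ennreal (bridge_integrand n t x y X) / ennreal (g x T y) * i
      = ennreal (bridge_integrand n t x y X) * i / ennreal (g x T y)" for X i
    by (simp add: divide_ennreal_def mult_ac)
  then show ?thesis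
    unfolding bridge_prob_def box_integral_def split
    by (simp only:) (rule nn_integral_divide[symmetric], measurable)
qed

text \<open>The ratios of \<open>v\<close> telescope to \<open>v (x n) (t n) / v a 0\<close>, whose numerator supplies the last kernel
  \<open>g b (T - t n) (x n)\<close>, up to symmetry; the value \<open>v a 0\<close> and the mass of \<open>\<phi>\<close> are inverse to each other.\<close>

lemma bridge_prob_backward:
  fixes a b :: "real ^ 'd"
  assumes n: "1 \<le> n" and grid: "time_grid T n t" and F: "\<forall>k\<in>{1..n}. F k \<in> sets borel"
  defines "v \<equiv> backward_sol g T a b"
  shows "bridge_prob n t F a b = (\<integral>\<^sup>+ x. ennreal (v x 0) *
    box_integral n F (\<lambda>X. let X = X(0 := x) in
      \<Prod>k=1..n. g (X (k - 1)) (t k - t (k - 1)) (X k)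
        * (v (X k) (t k) / v (X (k - 1)) (t (k - 1)))) \<partial>phi0 g T a b)"
proof -
  define w where "w = sqrt (g a T b)"
  have gT: "0 < g a T b"
    using T_pos by (intro positive) auto
  then have w: "0 < w" "w * w = g a T b" by (simp_all add: w_def)
  have v: "v x s = g x (T - s) b / w" "v x s > 0" if "s \<in> {0..<T}" for x s
    unfolding v_def using that gT positive[of "T - s" x b] by (simp_all add: backward_sol_eq w_def)
  have t: "t k \<in> {0..<T}" if "k \<le> n" for k
    using time_grid_bounds(1,2)[OF grid that] by simp
  have t0: "t 0 = 0" using grid by (simp add: time_grid_def)
  have density: "(\<Prod>k=1..n. g (Y (k - 1)) (t k - t (k - 1)) (Y k)
        * (v (Y k) (t k) / v (Y (k - 1)) (t (k - 1))))
      = bridge_integrand n t a b X / g a T b" if Y: "Y = X(0 := a)" for X Y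
  proof -
    have "(\<Prod>k=1..n. v (Y k) (t k) / v (Y (k - 1)) (t (k - 1))) = v (Y n) (t n) / v (Y 0) (t 0)"
    proof -
      have "v (Y k) (t k) \<noteq> 0" if "k \<le> n" for k
        using v(2)[OF t[OF that]] by (simp add: less_imp_neq[symmetric])
      then show ?thesis
        using prod_telescope''[of 0 n "\<lambda>k. v (Y k) (t k)"] by simp
    qed
    also have "\<dots> = g (Y n) (T - t n) b / g a T b"
      using v(1)[OF t] v(1)[of 0] T_pos t0 w by (simp add: Y)
    also have "g (Y n) (T - t n) b = g b (T - t n) (Y n)"
      using t[of n] by (intro symmetric) auto
    finally have ratio: "(\<Prod>k=1..n. v (Y k) (t k) / v (Y (k - 1)) (t (k - 1)))
      = g b (T - t n) (Y n) / g a T b" .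
    have "(\<Prod>k=1..n. g (Y (k - 1)) (t k - t (k - 1)) (Y k))
      = (\<Prod>k=1..n. g (Y k) (t k - t (k - 1)) (Y (k - 1)))"
    proof (rule prod.cong[OF refl])
      fix k assume "k \<in> {1..n}"
      then show "g (Y (k - 1)) (t k - t (k - 1)) (Y k) = g (Y k) (t k - t (k - 1)) (Y (k - 1))"
        using time_grid_bounds(5,6)[OF grid, of "k - 1"] by (intro symmetric) auto
    qed
    then show ?thesis
      unfolding prod.distrib ratio bridge_integrand_def Let_def Y[symmetric] by simp
  qed
  have "ennreal (v a 0) * (B * ennreal (1 / w)) = B" for B
  proof -
    have "ennreal (v a 0) * ennreal (1 / w) = 1"
      using v[of 0 a] w gT T_pos by (simp add: ennreal_mult[symmetric] less_imp_le)
    then show ?thesis by (metis mult.left_commute mult.right_neutral)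
  qed
  then show ?thesis
    unfolding phi0_def nn_integral_scaled_dirac w_def[symmetric] Let_def density[OF refl]
      bridge_prob_eq_box_integral[OF n grid F, symmetric]
    by (simp add: mult.assoc)
qed

text \<open>Here the ratios of \<open>u\<close> telescope to \<open>u (x 1) (t 1) / u b T\<close>, whose numerator supplies the first
  kernel \<open>g (x 1) (t 1) a\<close>. Both sides are compared with the product of all kernels along the path
  with the endpoints inserted, indexed by its \<open>n + 1\<close> steps.\<close>

lemma bridge_prob_forward:
  fixes a b :: "real ^ 'd"
  assumes n: "1 \<le> n" and grid: "time_grid T n t" and F: "\<forall>k\<in>{1..n}. F k \<in> sets borel"
  defines "u \<equiv> forward_sol g T a b"
  shows "bridge_prob n t F a b = (\<integral>\<^sup>+ x. ennreal (u x T) *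
    box_integral n F (\<lambda>X. let X = X(Suc n := x) in
      \<Prod>k=1..n. g (X (Suc k)) (t (Suc k) - t k) (X k)
        * (u (X k) (t k) / u (X (Suc k)) (t (Suc k)))) \<partial>psiT g T a b)"
proof -
  define w where "w = sqrt (g a T b)"
  have gT: "0 < g a T b"
    using T_pos by (intro positive) auto
  then have w: "0 < w" "w * w = g a T b" by (simp_all add: w_def)
  have u: "u x s = g x s a / w" "u x s > 0" if "s \<in> {0<..T}" for x s
    unfolding u_def using that gT positive[of s x a] by (simp_all add: forward_sol_eq w_def)
  have t: "t (Suc k) \<in> {0<..T}" if "k \<le> n" for k
    using time_grid_bounds(3,4)[OF grid that] by simp
  have ends: "t 0 = 0" "t (Suc n) = T" using grid by (auto simp: time_grid_def)
  have sym: "g b T a = g a T b"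
    using T_pos by (intro symmetric) auto
  have density: "(\<Prod>k=1..n. g (Y (Suc k)) (t (Suc k) - t k) (Y k)
        * (u (Y k) (t k) / u (Y (Suc k)) (t (Suc k))))
      = bridge_integrand n t a b X / g a T b" if Y: "Y = X(Suc n := b)" for X Y
  proof -
    define h where "h k = g ((Y(0 := a)) (Suc k)) (t (Suc k) - t k) ((Y(0 := a)) k)" for k
    have "(\<Prod>k=1..n. u (Y k) (t k) / u (Y (Suc k)) (t (Suc k))) = u (Y 1) (t 1) / u (Y (Suc n)) (t (Suc n))"
    proof (rule prod_ratio_telescope_down[OF n])
      show "u (Y (Suc k)) (t (Suc k)) \<noteq> 0" if "k \<le> n" for k
        using u(2)[OF t[OF that]] by (simp add: less_imp_neq[symmetric])
    qed
    also have "\<dots> = h 0 / g a T b"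
      using u(1)[OF t] u(1)[of T] T_pos n ends w sym by (simp add: Y h_def)
    finally have ratio: "(\<Prod>k=1..n. u (Y k) (t k) / u (Y (Suc k)) (t (Suc k))) = h 0 / g a T b" .
    have "(\<Prod>k=1..n. g (Y (Suc k)) (t (Suc k) - t k) (Y k)) = (\<Prod>k=1..n. h k)"
      by (intro prod.cong) (auto simp: h_def)
    moreover have "(\<Prod>k=1..n. h k) * h 0 = (\<Prod>k\<le>n. h k)"
      by (simp add: atMost_atLeast0 prod.atLeast_Suc_atMost mult.commute)
    moreover have "bridge_integrand n t a b X = (\<Prod>k\<le>n. h k)"
    proof -
      have "(\<Prod>k=1..n. g ((X(0 := a)) k) (t k - t (k - 1)) ((X(0 := a)) (k - 1))) = (\<Prod>k<n. h k)"
        unfolding One_nat_def prod.atLeast1_atMost_eq by (intro prod.cong) (auto simp: h_def Y)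
      moreover have "g b (T - t n) ((X(0 := a)) n) = h n"
        using n ends by (simp add: h_def Y)
      ultimately show ?thesis
        unfolding bridge_integrand_def Let_def by (simp add: lessThan_Suc_atMost[symmetric])
    qed
    ultimately show ?thesis
      unfolding prod.distrib ratio by simp
  qed
  have "ennreal (u b T) * (B * ennreal (1 / w)) = B" for B
  proof -
    have "ennreal (u b T) * ennreal (1 / w) = 1"
      using u[of T b] w gT T_pos sym by (simp add: ennreal_mult[symmetric] less_imp_le)
    then show ?thesis by (metis mult.left_commute mult.right_neutral)
  qed
  then show ?thesis
    unfolding psiT_def nn_integral_scaled_dirac w_def[symmetric] Let_def density[OF refl]
      bridge_prob_eq_box_integral[OF n grid F, symmetric]
    by (simp add: mult.assoc)
qed

definition two_step_grid :: "real \<Rightarrow> nat \<Rightarrow> real" where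
  "two_step_grid s k = (if k = 0 then 0 else if k = 1 then s else T)"

lemma time_grid_two_step:
  assumes "s \<in> {0<..<T}"
  shows "time_grid T 1 (two_step_grid s)"
  using assms by (auto simp: time_grid_def two_step_grid_def le_Suc_eq)

definition bridge_density :: "real \<Rightarrow> real ^ 'd \<Rightarrow> real ^ 'd \<Rightarrow> real ^ 'd \<Rightarrow> real" where
  "bridge_density s x y z = g z s x * g y (T - s) z / g x T y"

lemma measurable_bridge_density [measurable]:
  assumes "s \<in> {0<..<T}"
  shows "bridge_density s x y \<in> borel_measurable borel"
  unfolding bridge_density_def
  by (intro borel_measurable_divide borel_measurable_times measurable_kernel) (use assms in auto)

lemma bridge_density_pos: "s \<in> {0<..<T} \<Longrightarrow> 0 < bridge_density s x y z"
  unfolding bridge_density_def by (intro divide_pos_pos mult_pos_pos positive) auto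

lemma bridge_prob_one_time:
  assumes s: "s \<in> {0<..<T}" and F: "F \<in> sets borel"
  shows "bridge_prob 1 (two_step_grid s) (\<lambda>_. F) x y
    = (\<integral>\<^sup>+ z \<in> F. ennreal (bridge_density s x y z) \<partial>lborel)"
proof -
  interpret product_sigma_finite "\<lambda>_. lborel :: (real ^ 'd) measure"
    by standard
  note [measurable] = measurable_bridge_density[OF s] F
  have "bridge_prob 1 (two_step_grid s) (\<lambda>_. F) x y
      = (\<integral>\<^sup>+ X. ennreal (bridge_density s x y (X 1)) * indicator F (X 1) \<partial>Pi\<^sub>M {1::nat} (\<lambda>_. lborel))"
    using F
    unfolding bridge_prob_eq_box_integral[OF order_refl time_grid_two_step[OF s] ballI[OF F]]
      box_integral_def atLeastAtMost_singleton
    by (intro nn_integral_cong)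
      (auto simp: bridge_integrand_def bridge_density_def two_step_grid_def indicator_def space_PiM PiE_iff)
  also have "\<dots> = (\<integral>\<^sup>+ z \<in> F. ennreal (bridge_density s x y z) \<partial>lborel)"
    by (rule product_nn_integral_singleton) measurable
  finally show ?thesis .
qed

lemma pinned_three_times:
  assumes M: "bernstein_process_of T g (pair_law g T x y) M Z" and s: "s \<in> {0<..<T}"
    and F: "F0 \<in> sets borel" "F \<in> sets borel" "FT \<in> sets borel"
  shows "emeasure M {\<omega> \<in> space M. Z 0 \<omega> \<in> F0 \<and> Z s \<omega> \<in> F \<and> Z T \<omega> \<in> FT}
    = (\<integral>\<^sup>+ z \<in> F. ennreal (bridge_density s x y z) \<partial>lborel) * indicator (F0 \<times> FT) (x, y)"
  using pinned_fdd[OF M order_refl time_grid_two_step[OF s] F(1,3) ballI[OF F(2)]]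
  by (simp add: bridge_prob_one_time[OF s F(2)] two_step_grid_def flip: One_nat_def)

lemma pinned_fdd_interior:
  assumes M: "bernstein_process_of T g (pair_law g T x y) M Z"
    and ev: "1 \<le> n" "time_grid T n t" "\<forall>k\<in>{1..n}. F k \<in> sets borel"
  shows "emeasure M {\<omega> \<in> space M. \<forall>k\<in>{1..n}. Z (t k) \<omega> \<in> F k} = bridge_prob n t F x y"
  using pinned_fdd[OF M ev(1,2) _ _ ev(3), of UNIV UNIV] by simp

lemma pinned_interior:
  assumes M: "bernstein_process_of T g (pair_law g T x y) M Z" and s: "s \<in> {0<..<T}"
    and F: "F \<in> sets borel"
  shows "emeasure M {\<omega> \<in> space M. Z s \<omega> \<in> F} = (\<integral>\<^sup>+ z \<in> F. ennreal (bridge_density s x y z) \<partial>lborel)"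
  using pinned_three_times[OF M s _ F, of UNIV UNIV] by simp

text \<open>The total mass of the intermediate density is \<open>1\<close> because the process exists and has total
  probability \<open>1\<close>; since both endpoints are fixed, events at the endpoints have
  probability \<open>0\<close> or \<open>1\<close>.\<close>

lemma pinned_endpoints:
  assumes M: "bernstein_process_of T g (pair_law g T x y) M Z"
    and F: "F0 \<in> sets borel" "FT \<in> sets borel"
  shows "emeasure M {\<omega> \<in> space M. Z 0 \<omega> \<in> F0 \<and> Z T \<omega> \<in> FT} = indicator (F0 \<times> FT) (x, y)"
proof -
  have s: "T / 2 \<in> {0<..<T}" using T_pos by simp
  have "prob_space M" using M by (simp add: bernstein_process_of_def bernstein_process_def process_def)
  then have "(\<integral>\<^sup>+ z. ennreal (bridge_density (T / 2) x y z) \<partial>lborel) = 1"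
    using pinned_interior[OF M s, of UNIV] by (simp add: prob_space.emeasure_space_1)
  then show ?thesis
    using pinned_three_times[OF M s F(1) _ F(2), of UNIV] by simp
qed

lemma pinned_distr:
  assumes M: "bernstein_process_of T g (pair_law g T x y) M Z" and s: "s \<in> {0<..<T}"
  shows "distr M borel (Z s) = density lborel (\<lambda>z. ennreal (bridge_density s x y z))"
proof (rule measure_eqI)
  fix F assume "F \<in> sets (distr M borel (Z s))"
  then have F: "F \<in> sets borel" by simp
  have "Z s \<in> measurable M borel"
    using M s by (simp add: bernstein_process_of_def bernstein_process_def process_def)
  moreover have "Z s -` F \<inter> space M = {\<omega> \<in> space M. Z s \<omega> \<in> F}" by blast
  ultimately show "emeasure (distr M borel (Z s)) F
      = emeasure (density lborel (\<lambda>z. ennreal (bridge_density s x y z))) F"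
    using F pinned_interior[OF M s F] measurable_bridge_density[OF s]
    by (simp add: emeasure_distr emeasure_density)
qed simp

lemma bridge_density_eq_forward_backward:
  assumes s: "s \<in> {0<..<T}"
  shows "bridge_density s a b z = forward_sol g T a b z s * backward_sol g T a b z s"
proof -
  have "0 < g a T b"
    using T_pos by (intro positive) auto
  moreover have "g b (T - s) z = g z (T - s) b"
    using s by (intro symmetric) auto
  ultimately show ?thesis
    using s by (simp add: bridge_density_def forward_sol_eq backward_sol_eq)
qed

lemma pinned_expectation:
  fixes f :: "real ^ 'd \<Rightarrow> complex"
  assumes M: "bernstein_process_of T g (pair_law g T x y) M Z" and s: "s \<in> {0<..<T}"
    and f: "f \<in> borel_measurable borel" "\<And>z. cmod (f z) \<le> C"
  shows "integrable lborel (\<lambda>z. f z * complex_of_real (bridge_density s x y z))"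
    and "(LINT \<omega>|M. f (Z s \<omega>)) = (LINT z|lborel. f z * complex_of_real (bridge_density s x y z))"
proof -
  interpret prob_space M using M by (simp add: bernstein_process_of_def bernstein_process_def process_def)
  have Z: "Z s \<in> measurable M borel"
    using M s by (simp add: bernstein_process_of_def bernstein_process_def process_def)
  interpret law: prob_space "distr M borel (Z s)"
    by (rule prob_space_distr) fact
  have nonneg: "0 \<le> bridge_density s x y z" for z
    using bridge_density_pos[OF s] by (simp add: less_imp_le)
  have comm: "bridge_density s x y z *\<^sub>R f z = f z * complex_of_real (bridge_density s x y z)" for z
    by (simp add: scaleR_conv_of_real)
  have "integrable (distr M borel (Z s)) f"
    using f by (intro law.integrable_const_bound[where B = C]) auto
  then show "integrable lborel (\<lambda>z. f z * complex_of_real (bridge_density s x y z))"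
    unfolding pinned_distr[OF M s]
    using f(1) nonneg measurable_bridge_density[OF s] by (simp add: integrable_density comm)
  have "(LINT \<omega>|M. f (Z s \<omega>)) = (LINT z|distr M borel (Z s). f z)"
    using Z f(1) by (simp add: integral_distr)
  then show "(LINT \<omega>|M. f (Z s \<omega>)) = (LINT z|lborel. f z * complex_of_real (bridge_density s x y z))"
    unfolding pinned_distr[OF M s]
    using f(1) nonneg measurable_bridge_density[OF s] by (simp add: integral_density comm)
qed

end

section \<open>Mixtures of pinned processes\<close>

locale bernstein_mixture = positive_kernel T g
  for T :: real and g :: "real ^ 'd \<Rightarrow> real \<Rightarrow> real ^ 'd \<Rightarrow> real" +
  fixes P :: "'i::countable pmf" and a b :: "'i \<Rightarrow> real ^ 'd"
    and M :: "'i \<Rightarrow> 'w measure" and Z :: "'i \<Rightarrow> real \<Rightarrow> 'w \<Rightarrow> real ^ 'd"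
    and N :: "'v measure" and W :: "real \<Rightarrow> 'v \<Rightarrow> real ^ 'd"
  assumes components: "\<And>m. bernstein_process_of T g (pair_law g T (a m) (b m)) (M m) (Z m)"
    and mixture: "bernstein_process_of T g
      (distr (measure_pmf P) (borel \<Otimes>\<^sub>M borel) (\<lambda>m. (a m, b m))) N W"
begin

lemma process_mixture: "process T N W"
  using mixture by (simp add: bernstein_process_of_def bernstein_process_def)

lemma process_components: "process T (M m) (Z m)"
  using components by (simp add: bernstein_process_of_def bernstein_process_def)

lemma prob_space_mixture: "prob_space N" and prob_space_components: "prob_space (M m)"
  using process_mixture process_components by (simp_all add: process_def)

lemma emeasure_mixture_interior:
  assumes ev: "1 \<le> n" "time_grid T n t" "\<forall>k\<in>{1..n}. F k \<in> sets borel"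
  shows "emeasure N {\<omega> \<in> space N. \<forall>k\<in>{1..n}. W (t k) \<omega> \<in> F k}
    = (\<integral>\<^sup>+ m. emeasure (M m) {\<omega> \<in> space (M m). \<forall>k\<in>{1..n}. Z m (t k) \<omega> \<in> F k} \<partial>measure_pmf P)"
  using mixture_fdd[OF components mixture ev(1,2) _ _ ev(3), of UNIV UNIV] by simp

lemma emeasure_mixture_three_times:
  assumes s: "s \<in> {0<..<T}" and F: "F0 \<in> sets borel" "F \<in> sets borel" "FT \<in> sets borel"
  shows "emeasure N {\<omega> \<in> space N. W 0 \<omega> \<in> F0 \<and> W s \<omega> \<in> F \<and> W T \<omega> \<in> FT}
    = (\<integral>\<^sup>+ m. emeasure (M m) {\<omega> \<in> space (M m).
         Z m 0 \<omega> \<in> F0 \<and> Z m s \<omega> \<in> F \<and> Z m T \<omega> \<in> FT} \<partial>measure_pmf P)"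
  using mixture_fdd[OF components mixture order_refl time_grid_two_step[OF s] F(1,3) ballI[OF F(2)]]
  by (simp add: two_step_grid_def flip: One_nat_def)

lemma emeasure_mixture_one_time:
  assumes t: "t \<in> {0..T}" and F: "F \<in> sets borel"
  shows "emeasure N {\<omega> \<in> space N. W t \<omega> \<in> F}
    = (\<integral>\<^sup>+ m. emeasure (M m) {\<omega> \<in> space (M m). Z m t \<omega> \<in> F} \<partial>measure_pmf P)"
proof -
  have half: "T / 2 \<in> {0<..<T}" using T_pos by simp
  consider "t = 0" | "t = T" | "t \<in> {0<..<T}" using t by fastforce
  then show ?thesis
  proof cases
    case 1
    then show ?thesis using emeasure_mixture_three_times[OF half F, of UNIV UNIV] by simp
  next
    case 2
    then show ?thesis using emeasure_mixture_three_times[OF half _ _ F, of UNIV UNIV] by simp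
  next
    case 3
    then show ?thesis using emeasure_mixture_three_times[OF 3 _ F, of UNIV UNIV] by simp
  qed
qed

lemma has_sum_mixture_expectation:
  fixes f :: "real ^ 'd \<Rightarrow> complex"
  assumes t: "t \<in> {0..T}" and f: "f \<in> borel_measurable borel" "\<And>x. cmod (f x) \<le> C"
  shows "((\<lambda>m. complex_of_real (pmf P m) * (LINT \<omega>|M m. f (Z m t \<omega>)))
    has_sum (LINT \<omega>|N. f (W t \<omega>))) UNIV"
proof -
  have W: "W t \<in> measurable N borel" and Z: "Z m t \<in> measurable (M m) borel" for m
    using process_mixture process_components t by (auto simp: process_def)
  have "((\<lambda>m. complex_of_real (pmf P m) * (LINT x|distr (M m) borel (Z m t). f x))
    has_sum (LINT x|distr N borel (W t). f x)) UNIV"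
  proof (rule mixture_expectation[OF _ _ _ _ _ f])
    fix A :: "(real ^ 'd) set" assume A: "A \<in> sets borel"
    have "W t -` A \<inter> space N = {\<omega> \<in> space N. W t \<omega> \<in> A}"
      and "Z m t -` A \<inter> space (M m) = {\<omega> \<in> space (M m). Z m t \<omega> \<in> A}" for m by auto
    then show "emeasure (distr N borel (W t)) A
        = (\<integral>\<^sup>+ m. emeasure (distr (M m) borel (Z m t)) A \<partial>measure_pmf P)"
      using A W Z emeasure_mixture_one_time[OF t A] by (simp add: emeasure_distr)
  qed (use W Z prob_space_mixture prob_space_components in \<open>auto intro: prob_space.prob_space_distr\<close>)
  then show ?thesis
    using W Z f(1) by (simp add: integral_distr)
qed

text \<open>At time \<open>0\<close> the mixture charges every starting point of positive weight, whereas at time \<open>T / 2\<close> it has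
  a Lebesgue density and charges no point at all.\<close>

lemma not_stationary: "\<not> stationary T N W"
proof
  assume stat: "stationary T N W"
  have half: "T / 2 \<in> {0<..<T}" using T_pos by simp
  interpret prob_space N by (rule prob_space_mixture)
  obtain m0 where m0: "m0 \<in> set_pmf P"
    using set_pmf_not_empty[of P] by blast
  have "measure N {\<omega> \<in> space N. \<forall>k\<in>{1..1::nat}. W (0 + T / 2) \<omega> \<in> {a m0}}
      = measure N {\<omega> \<in> space N. \<forall>k\<in>{1..1::nat}. W 0 \<omega> \<in> {a m0}}"
    using stat[unfolded stationary_def, rule_format, of 1 "\<lambda>_. 0" "T / 2" "\<lambda>_. {a m0}"] T_pos
    by (auto simp: strict_mono_on_def)
  then have "emeasure N {\<omega> \<in> space N. W 0 \<omega> \<in> {a m0}} = emeasure N {\<omega> \<in> space N. W (T / 2) \<omega> \<in> {a m0}}"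
    by (simp add: emeasure_eq_measure)
  also have "\<dots> = 0"
  proof -
    have "AE z in lborel. z \<noteq> a m0"
      by (rule AE_lborel_singleton)
    then have "(\<integral>\<^sup>+ z \<in> {a m0}. ennreal (h z) \<partial>lborel) = (\<integral>\<^sup>+ z. 0 \<partial>(lborel :: (real ^ 'd) measure))" for h
      by (intro nn_integral_cong_AE) (auto elim!: eventually_mono simp: indicator_def)
    then have "emeasure (M m) {\<omega> \<in> space (M m). Z m (T / 2) \<omega> \<in> {a m0}} = 0" for m
      by (simp only: pinned_interior[OF components half borel_singleton[OF sets.empty_sets]]) simp
    then show ?thesis
      using half by (subst emeasure_mixture_one_time) (auto simp only: nn_integral_0_iff_AE, auto)
  qed
  finally have "(\<integral>\<^sup>+ m. indicator {a m0} (a m) \<partial>measure_pmf P) = 0"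
    using T_pos pinned_endpoints[OF components, of "{a m0}" UNIV]
    by (subst (asm) emeasure_mixture_one_time) (auto simp: indicator_times)
  then have "AE m in measure_pmf P. (indicator {a m0} (a m) :: ennreal) = 0"
    by (subst (asm) nn_integral_0_iff_AE) auto
  then show False
    using m0 by (auto simp: AE_measure_pmf_iff)
qed

text \<open>The density of the position at time \<open>s\<close> on the event that the process starts in \<open>F0\<close> and ends in \<open>FT\<close>.
  It has values in \<open>[0, \<infinity>]\<close>, because the sum over the index is finite only almost everywhere.\<close>

definition mixture_density ::
    "real \<Rightarrow> (real ^ 'd) set \<Rightarrow> (real ^ 'd) set \<Rightarrow> real ^ 'd \<Rightarrow> ennreal" where
  "mixture_density s F0 FT z =
    (\<integral>\<^sup>+ m. ennreal (bridge_density s (a m) (b m) z) * indicator (F0 \<times> FT) (a m, b m) \<partial>measure_pmf P)"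

lemma measurable_mixture_integrand:
  assumes "s \<in> {0<..<T}"
  shows "(\<lambda>(m, z). ennreal (bridge_density s (a m) (b m) z) * indicator (F0 \<times> FT) (a m, b m))
    \<in> borel_measurable (measure_pmf P \<Otimes>\<^sub>M lborel)"
proof -
  have "(\<lambda>(m, z). ennreal (bridge_density s (a m) (b m) z) * indicator (F0 \<times> FT) (a m, b m))
      \<in> borel_measurable (count_space UNIV \<Otimes>\<^sub>M lborel)"
    using measurable_bridge_density[OF assms]
    by (intro measurable_pair_measure_countable1) auto
  then show ?thesis
    by (simp cong: measurable_cong_sets sets_pair_measure_cong)
qed

lemma measurable_mixture_density:
  assumes "s \<in> {0<..<T}"
  shows "mixture_density s F0 FT \<in> borel_measurable borel"
proof -
  interpret pair_sigma_finite "measure_pmf P" "lborel :: (real ^ 'd) measure"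
    by (intro pair_sigma_finite.intro measure_pmf.sigma_finite_measure_axioms sigma_finite_lborel)
  have "(\<lambda>(z, m). ennreal (bridge_density s (a m) (b m) z) * indicator (F0 \<times> FT) (a m, b m))
      \<in> borel_measurable (lborel \<Otimes>\<^sub>M measure_pmf P)"
    using measurable_pair_swap[OF measurable_mixture_integrand[OF assms]] by (simp add: case_prod_beta')
  then have "mixture_density s F0 FT \<in> borel_measurable lborel"
    unfolding mixture_density_def[abs_def] by (rule measure_pmf.borel_measurable_nn_integral)
  then show ?thesis by simp
qed

lemma emeasure_three_times_density:
  assumes s: "s \<in> {0<..<T}" and F: "F0 \<in> sets borel" "F \<in> sets borel" "FT \<in> sets borel"
  shows "emeasure N {\<omega> \<in> space N. W 0 \<omega> \<in> F0 \<and> W s \<omega> \<in> F \<and> W T \<omega> \<in> FT}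
    = (\<integral>\<^sup>+ z \<in> F. mixture_density s F0 FT z \<partial>lborel)"
proof -
  interpret pair_sigma_finite "measure_pmf P" "lborel :: (real ^ 'd) measure"
    by (intro pair_sigma_finite.intro measure_pmf.sigma_finite_measure_axioms sigma_finite_lborel)
  define h where "h m z = ennreal (bridge_density s (a m) (b m) z) * indicator (F0 \<times> FT) (a m, b m)" for m z
  have [measurable]: "case_prod h \<in> borel_measurable (measure_pmf P \<Otimes>\<^sub>M lborel)"
    unfolding h_def using measurable_mixture_integrand[OF s] .
  have [measurable]: "h m \<in> borel_measurable borel" for m
    unfolding h_def using measurable_bridge_density[OF s, of "a m" "b m"] by simp
  note [measurable] = F(2) measurable_bridge_density[OF s]
  have "emeasure N {\<omega> \<in> space N. W 0 \<omega> \<in> F0 \<and> W s \<omega> \<in> F \<and> W T \<omega> \<in> FT}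
      = (\<integral>\<^sup>+ m. (\<integral>\<^sup>+ z. h m z * indicator F z \<partial>lborel) \<partial>measure_pmf P)"
    unfolding emeasure_mixture_three_times[OF s F] pinned_three_times[OF components s F] h_def
    by (intro nn_integral_cong, subst nn_integral_multc[symmetric]) (auto simp: mult_ac)
  also have "\<dots> = (\<integral>\<^sup>+ z. (\<integral>\<^sup>+ m. h m z * indicator F z \<partial>measure_pmf P) \<partial>lborel)"
    by (rule Fubini'[symmetric]) measurable
  also have "\<dots> = (\<integral>\<^sup>+ z \<in> F. mixture_density s F0 FT z \<partial>lborel)"
    by (simp add: nn_integral_multc mixture_density_def h_def)
  finally show ?thesis .
qed

text \<open>Put \<open>s = T / 2\<close>, and let \<open>R x\<close> be the density of the position at time \<open>s\<close> on the event that the process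
  starts at \<open>x\<close>, and \<open>R x y\<close> the density if it also ends at \<open>y\<close>. The Markov property says that the
  conditional probability of ending at \<open>y\<close> is a function \<open>k y\<close> of the position alone, so that
  \<open>R x y z = R x z * k y z\<close> for almost every \<open>z\<close>. On the other hand \<open>R x y z\<close> is the mass of \<open>(x, y)\<close> times
  \<open>g z s x * g y (T - s) z / g x T y\<close>. There are only countably many endpoints, so one \<open>z\<close> serves all of
  them, and at this \<open>z\<close> the mass has the product form.\<close>

lemma markovian_imp_product:
  assumes markov: "markovian T N W"
  shows "\<exists>\<phi> \<psi>. \<forall>x y. measure P {m. a m = x \<and> b m = y} = \<phi> x * g x T y * \<psi> y"
proof -
  define s where "s = T / 2"
  have s: "s \<in> {0<..<T}" using T_pos by (simp add: s_def)
  note [measurable] = measurable_mixture_density[OF s]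
  have W [measurable]: "W 0 \<in> measurable N borel" "W s \<in> measurable N borel"
    using process_mixture s by (auto simp: process_def)
  have "\<forall>y. \<exists>k. k \<in> borel_measurable borel \<and> (\<forall>A\<in>sets (sigma_gen N W {0..s}).
      emeasure N {\<omega> \<in> A. W T \<omega> \<in> {y}} = (\<integral>\<^sup>+ \<omega> \<in> A. k (W s \<omega>) \<partial>N))"
    using s markovian_transition[OF process_mixture markov, of s T "{_}", unfolded Bex_def] by simp
  then obtain k where transition: "\<forall>y. k y \<in> borel_measurable borel \<and>
      (\<forall>A\<in>sets (sigma_gen N W {0..s}).
        emeasure N {\<omega> \<in> A. W T \<omega> \<in> {y}} = (\<integral>\<^sup>+ \<omega> \<in> A. k y (W s \<omega>) \<partial>N))"
    by (rule choice[THEN exE])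
  then have k [measurable]: "k y \<in> borel_measurable borel" for y by (rule allE) (rule conjunct1)
  \<comment> \<open>Both sides integrate to the probability of starting at \<open>x\<close>, being in a given set at time \<open>s\<close> and
    ending at \<open>y\<close>; densities are unique.\<close>
  have factor: "AE z in lborel. mixture_density s {x} {y} z = mixture_density s {x} UNIV z * k y z" for x y
  proof (rule sigma_finite_measure.density_unique2[OF sigma_finite_lborel])
    have law: "distr (density N (\<lambda>\<omega>. indicator {x} (W 0 \<omega>))) borel (W s)
        = density lborel (mixture_density s {x} UNIV)"
    proof (rule measure_eqI)
      fix F assume "F \<in> sets (distr (density N (\<lambda>\<omega>. indicator {x} (W 0 \<omega>))) borel (W s))"
      then have F [measurable]: "F \<in> sets borel" by simp
      have "emeasure (distr (density N (\<lambda>\<omega>. indicator {x} (W 0 \<omega>))) borel (W s)) F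
          = (\<integral>\<^sup>+ \<omega>. indicator {x} (W 0 \<omega>) * indicator (W s -` F \<inter> space N) \<omega> \<partial>N)"
        by (simp add: emeasure_distr emeasure_density)
      also have "\<dots> = (\<integral>\<^sup>+ \<omega>. indicator {\<omega> \<in> space N. W 0 \<omega> \<in> {x} \<and> W s \<omega> \<in> F} \<omega> \<partial>N)"
        by (intro nn_integral_cong) (auto simp: indicator_def)
      also have "\<dots> = emeasure N {\<omega> \<in> space N. W 0 \<omega> \<in> {x} \<and> W s \<omega> \<in> F}"
        by (rule nn_integral_indicator) measurable
      also have "\<dots> = emeasure (density lborel (mixture_density s {x} UNIV)) F"
        using emeasure_three_times_density[OF s _ F, of "{x}" UNIV] by (simp add: emeasure_density)
      finally show "emeasure (distr (density N (\<lambda>\<omega>. indicator {x} (W 0 \<omega>))) borel (W s)) F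
          = emeasure (density lborel (mixture_density s {x} UNIV)) F" .
    qed simp
    fix F :: "(real ^ 'd) set" assume "F \<in> sets lborel"
    then have F [measurable]: "F \<in> sets borel" by simp
    define A where "A = {\<omega> \<in> space N. W 0 \<omega> \<in> {x}} \<inter> {\<omega> \<in> space N. W s \<omega> \<in> F}"
    have A: "A \<in> sets (sigma_gen N W {0..s})"
      unfolding A_def using s by (intro sets.Int in_sigma_gen) auto
    have "(\<integral>\<^sup>+ z \<in> F. mixture_density s {x} {y} z \<partial>lborel)
        = emeasure N {\<omega> \<in> space N. W 0 \<omega> \<in> {x} \<and> W s \<omega> \<in> F \<and> W T \<omega> \<in> {y}}"
      by (rule emeasure_three_times_density[OF s _ F, symmetric]) auto
    also have "{\<omega> \<in> space N. W 0 \<omega> \<in> {x} \<and> W s \<omega> \<in> F \<and> W T \<omega> \<in> {y}} = {\<omega> \<in> A. W T \<omega> \<in> {y}}"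
      by (auto simp: A_def)
    also have "emeasure N \<dots> = (\<integral>\<^sup>+ \<omega> \<in> A. k y (W s \<omega>) \<partial>N)"
      using transition A by (auto dest: spec[of _ y])
    also have "\<dots> = (\<integral>\<^sup>+ \<omega>. indicator {x} (W 0 \<omega>) * (k y (W s \<omega>) * indicator F (W s \<omega>)) \<partial>N)"
      by (intro nn_integral_cong) (auto simp: A_def indicator_def)
    also have "\<dots> = (\<integral>\<^sup>+ \<omega>. k y (W s \<omega>) * indicator F (W s \<omega>)
        \<partial>density N (\<lambda>\<omega>. indicator {x} (W 0 \<omega>)))"
      by (rule nn_integral_density[symmetric]) measurable
    also have "\<dots> = (\<integral>\<^sup>+ z. k y z * indicator F z
        \<partial>distr (density N (\<lambda>\<omega>. indicator {x} (W 0 \<omega>))) borel (W s))"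
      by (rule nn_integral_distr[symmetric]) measurable
    also have "\<dots> = (\<integral>\<^sup>+ z \<in> F. mixture_density s {x} UNIV z * k y z \<partial>lborel)"
      unfolding law by (subst nn_integral_density) (auto simp: mult.assoc)
    finally show "(\<integral>\<^sup>+ z \<in> F. mixture_density s {x} {y} z \<partial>lborel)
        = (\<integral>\<^sup>+ z \<in> F. mixture_density s {x} UNIV z * k y z \<partial>lborel)" .
  qed measurable
  \<comment> \<open>Only the pairs \<open>(a m, b n)\<close> matter, and there are countably many of them.\<close>
  have "AE z in lborel. \<forall>m n. mixture_density s {a m} {b n} z
      = mixture_density s {a m} UNIV z * k (b n) z"
    unfolding AE_all_countable using factor by blast
  moreover have "ae_filter (lborel :: (real ^ 'd) measure) \<noteq> bot"
    by (simp add: ae_filter_eq_bot_iff)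
  ultimately obtain z where z: "\<And>m n. mixture_density s {a m} {b n} z
      = mixture_density s {a m} UNIV z * k (b n) z"
    using eventually_happens' by blast
  define \<phi> where "\<phi> x = (if x \<in> range a then enn2real (mixture_density s {x} UNIV z) / g z s x else 0)" for x
  define \<psi> where "\<psi> y = (if y \<in> range b then enn2real (k y z) / g y (T - s) z else 0)" for y
  have "measure P {m. a m = x \<and> b m = y} = \<phi> x * g x T y * \<psi> y" for x y
  proof (cases "x \<in> range a \<and> y \<in> range b")
    case True
    have "mixture_density s {x} {y} z
        = (\<integral>\<^sup>+ m. ennreal (bridge_density s x y z) * indicator {m. a m = x \<and> b m = y} m \<partial>measure_pmf P)"
      unfolding mixture_density_def by (intro nn_integral_cong) (auto simp: indicator_def)
    then have "mixture_density s {x} {y} z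
        = ennreal (bridge_density s x y z) * emeasure P {m. a m = x \<and> b m = y}"
      by (simp add: nn_integral_cmult_indicator)
    moreover have "mixture_density s {x} {y} z = mixture_density s {x} UNIV z * k y z"
      using True z by auto
    ultimately have "enn2real (ennreal (bridge_density s x y z) * emeasure P {m. a m = x \<and> b m = y})
        = enn2real (mixture_density s {x} UNIV z * k y z)"
      by simp
    \<comment> \<open>\<open>enn2real\<close> is multiplicative also at infinity, so the value \<open>\<infinity>\<close> of the density or of \<open>k y z\<close> is covered.\<close>
    then have "bridge_density s x y z * measure P {m. a m = x \<and> b m = y}
        = enn2real (mixture_density s {x} UNIV z) * enn2real (k y z)"
      using bridge_density_pos[OF s, of x y z] by (simp add: enn2real_mult measure_def)
    moreover have "0 < g z s x" "0 < g y (T - s) z" "0 < g x T y"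
      using s by (auto intro!: positive)
    ultimately show ?thesis
      using True unfolding \<phi>_def \<psi>_def bridge_density_def by (simp add: field_simps)
  next
    case False
    then have empty: "{m. a m = x \<and> b m = y} = {}" by auto
    show ?thesis unfolding empty using False by (auto simp: \<phi>_def \<psi>_def)
  qed
  then show ?thesis by blast
qed

end

section \<open>The mixture over all pairs of endpoints\<close>

theorem theorem2:
  fixes V :: "real ^ 'd \<Rightarrow> real"
    and T :: real
    and E :: "nat ^ 'd \<Rightarrow> real"
    and e :: "nat ^ 'd \<Rightarrow> real ^ 'd \<Rightarrow> complex"
    and g :: "real ^ 'd \<Rightarrow> real \<Rightarrow> real ^ 'd \<Rightarrow> real"
    and a b :: "nat ^ 'd \<Rightarrow> real ^ 'd"
    and p :: "nat ^ 'd \<Rightarrow> real"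
    and \<mu>bar :: "((real ^ 'd) \<times> (real ^ 'd)) measure"
    and M :: "nat ^ 'd \<Rightarrow> 'w measure"
    and Z :: "nat ^ 'd \<Rightarrow> real \<Rightarrow> 'w \<Rightarrow> real ^ 'd"
    and Mbar :: "'v measure"
    and Zbar :: "real \<Rightarrow> 'v \<Rightarrow> real ^ 'd"
  defines "\<phi> \<equiv> \<lambda>m. phi0 g T (a m) (b m)"
    and "\<psi> \<equiv> \<lambda>m. psiT g T (a m) (b m)"
    and "\<mu> \<equiv> \<lambda>m. pair_law g T (a m) (b m)"
    and "u \<equiv> \<lambda>m. forward_sol g T (a m) (b m)"
    and "v \<equiv> \<lambda>m. backward_sol g T (a m) (b m)"
  assumes "T > 0"
    and "hypothesis_H V"
    and "eigenbasis V E e"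
    and "\<forall>t\<in>{0<..T}. (\<lambda>m. exp (- t * E m)) summable_on UNIV"
    and "green_function T E e g"
    and "\<forall>m. bernstein_process_of T g (\<mu> m) (M m) (Z m)"
    and "\<forall>m. p m > 0" and "(p has_sum 1) UNIV"
    and "prob_space \<mu>bar" and "sets \<mu>bar = sets (borel \<Otimes>\<^sub>M borel)"
    and "\<forall>A\<in>sets \<mu>bar. ((\<lambda>m. p m * measure (\<mu> m) A) has_sum measure \<mu>bar A) UNIV"
    and "bernstein_process_of T g \<mu>bar Mbar Zbar"
  shows
    "(\<not> stationary T Mbar Zbar \<and>
      (\<not> product_form g T p a b \<longrightarrow> \<not> markovian T Mbar Zbar) \<and>
      (\<forall>n\<ge>1. \<forall>t F. time_grid T n t \<and> (\<forall>k\<in>{1..n}. F k \<in> sets borel) \<longrightarrow>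
         ((\<lambda>m. p m * measure (M m) {\<omega> \<in> space (M m). \<forall>k\<in>{1..n}. Z m (t k) \<omega> \<in> F k})
            has_sum measure Mbar {\<omega> \<in> space Mbar. \<forall>k\<in>{1..n}. Zbar (t k) \<omega> \<in> F k}) UNIV \<and>
         (\<forall>m. emeasure (M m) {\<omega> \<in> space (M m). \<forall>k\<in>{1..n}. Z m (t k) \<omega> \<in> F k}
              = (\<integral>\<^sup>+ x. ennreal (v m x 0) *
                  box_integral n F (\<lambda>X. let X = X(0 := x) in
                    \<Prod>k=1..n. g (X (k - 1)) (t k - t (k - 1)) (X k)
                             * (v m (X k) (t k) / v m (X (k - 1)) (t (k - 1)))) \<partial>\<phi> m)) \<and>
         (\<forall>m. emeasure (M m) {\<omega> \<in> space (M m). \<forall>k\<in>{1..n}. Z m (t k) \<omega> \<in> F k}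
              = (\<integral>\<^sup>+ x. ennreal (u m x T) *
                  box_integral n F (\<lambda>X. let X = X(Suc n := x) in
                    \<Prod>k=1..n. g (X (Suc k)) (t (Suc k) - t k) (X k)
                             * (u m (X k) (t k) / u m (X (Suc k)) (t (Suc k)))) \<partial>\<psi> m))))
     \<and>
     (\<forall>F\<in>sets borel.
        (\<forall>t\<in>{0..T}.
           ((\<lambda>m. p m * measure (M m) {\<omega> \<in> space (M m). Z m t \<omega> \<in> F})
              has_sum measure Mbar {\<omega> \<in> space Mbar. Zbar t \<omega> \<in> F}) UNIV) \<and>
        (\<forall>m. \<forall>t\<in>{0<..<T}.
           emeasure (M m) {\<omega> \<in> space (M m). Z m t \<omega> \<in> F}
           = (\<integral>\<^sup>+ x \<in> F. ennreal (u m x t * v m x t) \<partial>lborel)) \<and>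
        (\<forall>m. measure (M m) {\<omega> \<in> space (M m). Z m 0 \<omega> \<in> F} = (if a m \<in> F then 1 else 0)) \<and>
        (\<forall>m. measure (M m) {\<omega> \<in> space (M m). Z m T \<omega> \<in> F} = (if b m \<in> F then 1 else 0)))
     \<and>
     (\<forall>f :: real ^ 'd \<Rightarrow> complex. f \<in> borel_measurable borel \<and> bounded (range f) \<longrightarrow>
        (\<forall>t\<in>{0..T}.
           ((\<lambda>m. complex_of_real (p m) * (LINT \<omega>|M m. f (Z m t \<omega>)))
              has_sum (LINT \<omega>|Mbar. f (Zbar t \<omega>))) UNIV) \<and>
        (\<forall>m. \<forall>t\<in>{0<..<T}.
           integrable lborel (\<lambda>x. f x * complex_of_real (u m x t * v m x t)) \<and>
           (LINT \<omega>|M m. f (Z m t \<omega>))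
           = (LINT x|lborel. f x * complex_of_real (u m x t * v m x t))))"
proof -
  have T: "0 < T" and heat: "green_function T E e g" by fact+
  have kernel: "positive_kernel T g"
    using T heat by unfold_locales (auto simp: green_function_def)
  interpret positive_kernel T g by (rule kernel)
  have p: "\<And>m. 0 \<le> p m" "(p has_sum 1) UNIV"
    using \<open>\<forall>m. p m > 0\<close> \<open>(p has_sum 1) UNIV\<close> by (auto intro: less_imp_le)
  obtain P where P: "\<And>m. pmf P m = p m"
    using pmf_of_weights[OF p] by blast
  have pair_law: "measure (\<mu> m) A = indicator A (a m, b m)" if "A \<in> sets (borel \<Otimes>\<^sub>M borel)" for m A
    using that by (simp add: \<mu>_def pair_law_eq_return measure_return)
  have \<mu>bar: "\<mu>bar = distr (measure_pmf P) (borel \<Otimes>\<^sub>M borel) (\<lambda>m. (a m, b m))"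
  proof (rule measure_eqI)
    show "sets \<mu>bar = sets (distr (measure_pmf P) (borel \<Otimes>\<^sub>M borel) (\<lambda>m. (a m, b m)))"
      using \<open>sets \<mu>bar = sets (borel \<Otimes>\<^sub>M borel)\<close> by simp
    fix A assume A: "A \<in> sets \<mu>bar"
    then have A': "A \<in> sets (borel \<Otimes>\<^sub>M borel)"
      using \<open>sets \<mu>bar = sets (borel \<Otimes>\<^sub>M borel)\<close> by simp
    interpret mubar: prob_space \<mu>bar by fact
    have indicator: "indicator A (a m, b m) = indicat_real {m. (a m, b m) \<in> A} m" for m
      by (simp add: indicator_def)
    have "((\<lambda>m. p m * indicat_real {m. (a m, b m) \<in> A} m) has_sum measure \<mu>bar A) UNIV"
      using bspec[OF \<open>\<forall>A\<in>sets \<mu>bar. ((\<lambda>m. p m * measure (\<mu> m) A) has_sum measure \<mu>bar A) UNIV\<close> A]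
      by (simp only: pair_law[OF A'] indicator)
    moreover have "((\<lambda>m. p m * indicat_real {m. (a m, b m) \<in> A} m) has_sum
        measure P {m. (a m, b m) \<in> A}) UNIV"
      using has_sum_pmf_expectation[of "indicat_real {m. (a m, b m) \<in> A}" 1 P] P by simp
    ultimately have "measure \<mu>bar A = measure P {m. (a m, b m) \<in> A}"
      by (rule has_sum_unique)
    then show "emeasure \<mu>bar A = emeasure (distr (measure_pmf P) (borel \<Otimes>\<^sub>M borel) (\<lambda>m. (a m, b m))) A"
      using A' by (subst emeasure_distr)
        (auto simp: mubar.emeasure_eq_measure measure_pmf.emeasure_eq_measure vimage_def
          measurable_pmf_measure1 space_pair_measure)
  qed
  have components: "bernstein_process_of T g (pair_law g T (a m) (b m)) (M m) (Z m)" for m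
    using \<open>\<forall>m. bernstein_process_of T g (\<mu> m) (M m) (Z m)\<close> by (simp add: \<mu>_def)
  interpret bernstein_mixture T g P a b M Z Mbar Zbar
    using \<open>bernstein_process_of T g \<mu>bar Mbar Zbar\<close> components
    by unfold_locales (simp_all add: \<mu>bar)
  have uv: "bridge_density t (a m) (b m) x = u m x t * v m x t" if "t \<in> {0<..<T}" for t m x
    using that by (simp add: u_def v_def bridge_density_eq_forward_backward)
  have not_markovian: "\<not> markovian T Mbar Zbar" if "\<not> product_form g T p a b"
  proof
    assume "markovian T Mbar Zbar"
    then have "\<exists>\<phi> \<psi>. \<forall>x y. measure P {m. a m = x \<and> b m = y} = \<phi> x * g x T y * \<psi> y"
      by (rule markovian_imp_product)
    moreover have "measure P S = (\<Sum>\<^sub>\<infinity>m\<in>S. p m)" for S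
    proof -
      have "pmf P = p" using P by blast
      then show ?thesis
        using measure_pmf_conv_infsetsum[of P S] infsetsum_infsum[OF pmf_abs_summable, of P S] by simp
    qed
    ultimately have "product_form g T p a b"
      by (simp only: product_form_def)
    then show False using that by contradiction
  qed
  have fdd: "((\<lambda>m. p m * measure (M m) {\<omega> \<in> space (M m). \<forall>k\<in>{1..n}. Z m (t k) \<omega> \<in> F k})
      has_sum measure Mbar {\<omega> \<in> space Mbar. \<forall>k\<in>{1..n}. Zbar (t k) \<omega> \<in> F k}) UNIV"
    if n: "1 \<le> n" and ev: "time_grid T n t \<and> (\<forall>k\<in>{1..n}. F k \<in> sets borel)" for n t F
    unfolding P[symmetric]
    by (rule mixture_has_sum[where K = M, OF prob_space_mixture prob_space_components])
      (rule emeasure_mixture_interior[OF n ev[THEN conjunct1] ev[THEN conjunct2]])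
  have fdd_backward: "emeasure (M m) {\<omega> \<in> space (M m). \<forall>k\<in>{1..n}. Z m (t k) \<omega> \<in> F k}
      = (\<integral>\<^sup>+ x. ennreal (v m x 0) *
          box_integral n F (\<lambda>X. let X = X(0 := x) in
            \<Prod>k=1..n. g (X (k - 1)) (t k - t (k - 1)) (X k)
                     * (v m (X k) (t k) / v m (X (k - 1)) (t (k - 1)))) \<partial>\<phi> m)"
    and fdd_forward: "emeasure (M m) {\<omega> \<in> space (M m). \<forall>k\<in>{1..n}. Z m (t k) \<omega> \<in> F k}
      = (\<integral>\<^sup>+ x. ennreal (u m x T) *
          box_integral n F (\<lambda>X. let X = X(Suc n := x) in
            \<Prod>k=1..n. g (X (Suc k)) (t (Suc k) - t k) (X k)
                     * (u m (X k) (t k) / u m (X (Suc k)) (t (Suc k)))) \<partial>\<psi> m)"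
    if n: "1 \<le> n" and ev: "time_grid T n t \<and> (\<forall>k\<in>{1..n}. F k \<in> sets borel)" for n t F m
    unfolding pinned_fdd_interior[OF components n ev[THEN conjunct1] ev[THEN conjunct2]] \<phi>_def \<psi>_def u_def v_def
    using bridge_prob_backward[OF n ev[THEN conjunct1] ev[THEN conjunct2]]
      bridge_prob_forward[OF n ev[THEN conjunct1] ev[THEN conjunct2]]
    by blast+
  have one_time: "((\<lambda>m. p m * measure (M m) {\<omega> \<in> space (M m). Z m t \<omega> \<in> F})
      has_sum measure Mbar {\<omega> \<in> space Mbar. Zbar t \<omega> \<in> F}) UNIV"
    if "t \<in> {0..T}" "F \<in> sets borel" for t F
    unfolding P[symmetric]
    by (rule mixture_has_sum[where K = M, OF prob_space_mixture prob_space_components])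
      (rule emeasure_mixture_one_time[OF that])
  have one_time_density: "emeasure (M m) {\<omega> \<in> space (M m). Z m t \<omega> \<in> F}
      = (\<integral>\<^sup>+ x \<in> F. ennreal (u m x t * v m x t) \<partial>lborel)"
    if "t \<in> {0<..<T}" "F \<in> sets borel" for t F m
    using pinned_interior[OF components that] that(1) by (simp only: uv)
  have start_point: "measure (M m) {\<omega> \<in> space (M m). Z m 0 \<omega> \<in> F} = (if a m \<in> F then 1 else 0)"
    and end_point: "measure (M m) {\<omega> \<in> space (M m). Z m T \<omega> \<in> F} = (if b m \<in> F then 1 else 0)"
    if "F \<in> sets borel" for F m
    using pinned_endpoints[OF components that, of UNIV m] pinned_endpoints[OF components _ that, of UNIV m]
    by (simp_all add: measure_def)
  have expectation: "((\<lambda>m. complex_of_real (p m) * (LINT \<omega>|M m. f (Z m t \<omega>)))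
      has_sum (LINT \<omega>|Mbar. f (Zbar t \<omega>))) UNIV"
    if f: "f \<in> borel_measurable borel \<and> bounded (range f)" and t: "t \<in> {0..T}"
    for f :: "real ^ 'd \<Rightarrow> complex" and t
  proof -
    obtain C where "\<And>x. cmod (f x) \<le> C"
      using f by (auto simp: bounded_iff)
    with f show ?thesis
      unfolding P[symmetric] by (intro has_sum_mixture_expectation[OF t]) auto
  qed
  have integrable_density: "integrable lborel (\<lambda>x. f x * complex_of_real (u m x t * v m x t))"
    and expectation_density: "(LINT \<omega>|M m. f (Z m t \<omega>)) = (LINT x|lborel. f x * complex_of_real (u m x t * v m x t))"
    if f: "f \<in> borel_measurable borel \<and> bounded (range f)" and t: "t \<in> {0<..<T}"
    for f :: "real ^ 'd \<Rightarrow> complex" and t m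
  proof -
    obtain C where "\<And>x. cmod (f x) \<le> C"
      using f by (auto simp: bounded_iff)
    note pinned = pinned_expectation[OF components t conjunct1[OF f] this, of m]
    from pinned show "integrable lborel (\<lambda>x. f x * complex_of_real (u m x t * v m x t))"
      and "(LINT \<omega>|M m. f (Z m t \<omega>)) = (LINT x|lborel. f x * complex_of_real (u m x t * v m x t))"
      by (simp_all only: uv[OF t])
  qed
  show ?thesis
    by (intro conjI allI ballI impI)
      (rule not_stationary, erule not_markovian, (rule fdd; assumption),
        (rule fdd_backward; assumption), (rule fdd_forward; assumption),
        (rule one_time; assumption), (rule one_time_density; assumption),
        (rule start_point; assumption), (rule end_point; assumption),
        (rule expectation; assumption), (rule integrable_density; assumption),
        (rule expectation_density; assumption))
qed

end
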